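(* (Generalized Ozawa error--disturbance inequality.) Let $\rho$ and $\rho_{\mathrm{app}}$ be states of the system and of the apparatus, with largest and smallest eigenvalues $\lambda_{\max},\lambda_{\min}$ and $\mu_{\max},\mu_{\min}$ respectively, such that $\lambda_{\max}\mu_{\max}\neq\lambda_{\min}\mu_{\min}$. Let $A,B$ be observables of the system, let $A_{\mathrm{app}}$ be a meter observable of the apparatus, and let $U$ be a unitary on the composite system. Then $$\varepsilon(A)\eta(B)+\varepsilon(A)\sigma(B)+\sigma(A)\eta(B)\ \ge\ \frac{\lambda_{\max}\mu_{\max}+\lambda_{\min}\mu_{\min}}{2\bigl(\lambda_{\max}\mu_{\max}-\lambda_{\min}\mu_{\min}\bigr)}\,\bigl|\langle[A,B]\rangle_\rho\bigr| .$$
   Context: The system and the apparatus have complex separable Hilbert spaces $\mathcal{H}$ and $\mathcal{K}$; the composite system has Hilbert space $\mathcal{H}\otimes\mathcal{K}$ and initial state $\rho\otimes\rho_{\mathrm{app}}$. States are positive semidefinite trace-class operators of trace one; observables are (bounded) Hermitian operators. In infinite dimension the smallest eigenvalue of a state is understood as the infimum of its spectrum, i.e. $0$. $\langle X\rangle_\rho:=\operatorname{Tr}[X\rho]$, $[A,B]:=AB-BA$, and $\sigma(X):=\sqrt{\operatorname{Tr}[(X-\langle X\rangle_\rho\mathbb{I})^2\rho]}$ is the standard deviation of $X$ in $\rho$. $U$ is the unitary operator on $\mathcal{H}\otimes\mathcal{K}$ describing the measurement interaction. The error of $A$ is $\varepsilon(A):=\sqrt{\operatorname{Tr}[(\rho\otimes\rho_{\mathrm{app}})N_A^2]}$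 with $N_A:=U^\dagger(\mathbb{I}\otimes A_{\mathrm{app}})U-A\otimes\mathbb{I}$. The disturbance of $B$ is $\eta(B):=\sqrt{\operatorname{Tr}[(\rho\otimes\rho_{\mathrm{app}})(U^\dagger(B\otimes\mathbb{I})U-B\otimes\mathbb{I})^2]}$. *)

theory Defs
  imports "HOL-Analysis.Analysis"
begin

section \<open>Complex Hilbert spaces\<close>

text \<open>The inner product is antilinear in its first argument. The last axiom says that the norm of
  the Banach space is the one induced by the inner product; positivity and definiteness of the
  inner product follow from it. Separability is the additional sort
  \<^class>\<open>second_countable_topology\<close>, which for metric spaces is equivalent to it.\<close>

class complex_hilbert_space = banach +
  fixes scaleC :: "complex \<Rightarrow> 'a \<Rightarrow> 'a" (infixr "*\<^sub>C" 75)
    and cinner :: "'a \<Rightarrow> 'a \<Rightarrow> complex"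
  assumes scaleC_add_right: "c *\<^sub>C (x + y) = c *\<^sub>C x + c *\<^sub>C y"
    and scaleC_add_left: "(c + d) *\<^sub>C x = c *\<^sub>C x + d *\<^sub>C x"
    and scaleC_scaleC: "c *\<^sub>C (d *\<^sub>C x) = (c * d) *\<^sub>C x"
    and scaleC_one: "1 *\<^sub>C x = x"
    and scaleR_scaleC: "r *\<^sub>R x = complex_of_real r *\<^sub>C x"
    and cinner_commute: "cinner x y = cnj (cinner y x)"
    and cinner_add_right: "cinner x (y + z) = cinner x y + cinner x z"
    and cinner_scaleC_right: "cinner x (c *\<^sub>C y) = c * cinner x y"
    and cinner_norm: "cinner x x = complex_of_real ((norm x)\<^sup>2)"

global_interpretation complex_vector:
  vector_space "scaleC :: complex \<Rightarrow> 'a::complex_hilbert_space \<Rightarrow> 'a"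
  by unfold_locales (rule scaleC_add_right scaleC_add_left scaleC_scaleC scaleC_one)+

section \<open>Operators\<close>

definition bounded_clinear :: "('a::complex_hilbert_space \<Rightarrow> 'b::complex_hilbert_space) \<Rightarrow> bool" where
  "bounded_clinear T \<longleftrightarrow>
     (\<forall>x y. T (x + y) = T x + T y) \<and> (\<forall>c x. T (c *\<^sub>C x) = c *\<^sub>C T x) \<and>
     (\<exists>K. \<forall>x. norm (T x) \<le> norm x * K)"

definition cadjoint ::
  "('a::complex_hilbert_space \<Rightarrow> 'b::complex_hilbert_space) \<Rightarrow> 'b \<Rightarrow> 'a" where
  "cadjoint T = (THE S. \<forall>x y. cinner (S x) y = cinner x (T y))"

definition hermitian :: "('a::complex_hilbert_space \<Rightarrow> 'a) \<Rightarrow> bool" where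
  "hermitian T \<longleftrightarrow> bounded_clinear T \<and> (\<forall>x y. cinner (T x) y = cinner x (T y))"

definition unitary :: "('a::complex_hilbert_space \<Rightarrow> 'b::complex_hilbert_space) \<Rightarrow> bool" where
  "unitary U \<longleftrightarrow> bounded_clinear U \<and> surj U \<and> (\<forall>x y. cinner (U x) (U y) = cinner x y)"

definition positive_op :: "('a::complex_hilbert_space \<Rightarrow> 'a) \<Rightarrow> bool" where
  "positive_op T \<longleftrightarrow> bounded_clinear T \<and> (\<forall>x. cinner x (T x) \<in> \<real>\<^sub>\<ge>\<^sub>0)"

definition commutator :: "('a::complex_hilbert_space \<Rightarrow> 'a) \<Rightarrow> ('a \<Rightarrow> 'a) \<Rightarrow> 'a \<Rightarrow> 'a" where
  "commutator A B = (\<lambda>x. A (B x) - B (A x))"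

definition eigenvalue :: "('a::complex_hilbert_space \<Rightarrow> 'a) \<Rightarrow> complex \<Rightarrow> bool" where
  "eigenvalue T c \<longleftrightarrow> (\<exists>x. x \<noteq> 0 \<and> T x = c *\<^sub>C x)"

definition spectrum :: "('a::complex_hilbert_space \<Rightarrow> 'a) \<Rightarrow> complex set" where
  "spectrum T = {c. \<not> (\<exists>S. bounded_clinear S \<and>
     (\<forall>x. S (T x - c *\<^sub>C x) = x) \<and> (\<forall>x. T (S x) - c *\<^sub>C S x = x))}"

text \<open>The following two notions are used for states only. A state is positive and compact, so all
  its eigenvalues are real and the largest one exists.\<close>

definition largest_eigenvalue :: "('a::complex_hilbert_space \<Rightarrow> 'a) \<Rightarrow> real" where
  "largest_eigenvalue T = (GREATEST r. eigenvalue T (complex_of_real r))"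

definition smallest_eigenvalue :: "('a::complex_hilbert_space \<Rightarrow> 'a) \<Rightarrow> real" where
  "smallest_eigenvalue T =
     (if \<exists>S :: 'a set. finite S \<and> complex_vector.span S = UNIV
      then (LEAST r. eigenvalue T (complex_of_real r))
      else Inf {r. complex_of_real r \<in> spectrum T})"

section \<open>Trace and states\<close>

definition is_onb :: "'a::complex_hilbert_space set \<Rightarrow> bool" where
  "is_onb E \<longleftrightarrow> (\<forall>e\<in>E. norm e = 1) \<and> (\<forall>e\<in>E. \<forall>f\<in>E. e \<noteq> f \<longrightarrow> cinner e f = 0) \<and>
     closure (complex_vector.span E) = UNIV"

definition abs_op :: "('a::complex_hilbert_space \<Rightarrow> 'a) \<Rightarrow> 'a \<Rightarrow> 'a" where
  "abs_op T = (THE P. positive_op P \<and> P \<circ> P = cadjoint T \<circ> T)"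

definition trace_class :: "('a::complex_hilbert_space \<Rightarrow> 'a) \<Rightarrow> bool" where
  "trace_class T \<longleftrightarrow> bounded_clinear T \<and>
     (\<exists>E. is_onb E \<and> (\<lambda>e. cinner e (abs_op T e)) summable_on E)"

text \<open>The choice of the orthonormal basis is immaterial when the operator is trace class;
  the trace is only ever taken of such operators below (products of a bounded operator with a
  state).\<close>

definition op_trace :: "('a::complex_hilbert_space \<Rightarrow> 'a) \<Rightarrow> complex" where
  "op_trace T = (\<Sum>\<^sub>\<infinity>e\<in>(SOME E. is_onb E). cinner e (T e))"

definition state :: "('a::complex_hilbert_space \<Rightarrow> 'a) \<Rightarrow> bool" where
  "state \<rho> \<longleftrightarrow> positive_op \<rho> \<and> trace_class \<rho> \<and> op_trace \<rho> = 1"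

definition expect :: "('a::complex_hilbert_space \<Rightarrow> 'a) \<Rightarrow> ('a \<Rightarrow> 'a) \<Rightarrow> complex" where
  "expect \<rho> X = op_trace (X \<circ> \<rho>)"

text \<open>The real parts below, and in the definitions of error and disturbance, are taken of traces
  that are nonnegative real numbers.\<close>

definition std_dev :: "('a::complex_hilbert_space \<Rightarrow> 'a) \<Rightarrow> ('a \<Rightarrow> 'a) \<Rightarrow> real" where
  "std_dev \<rho> X =
     (let X0 = (\<lambda>x. X x - expect \<rho> X *\<^sub>C x) in sqrt (Re (op_trace (X0 \<circ> X0 \<circ> \<rho>))))"

section \<open>Tensor products\<close>

text \<open>A Hilbert space tensor product of two Hilbert spaces is a Hilbert space together with a
  bilinear map \<open>(x, y) \<mapsto> x \<otimes> y\<close> such that the inner product of elementary tensors is the product of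
  the inner products and the elementary tensors span a dense subspace. This determines it uniquely
  up to a unitary map that respects elementary tensors.\<close>

definition hilbert_tensor_product ::
  "('h::complex_hilbert_space \<Rightarrow> 'k::complex_hilbert_space \<Rightarrow> 'hk::complex_hilbert_space) \<Rightarrow> bool" where
  "hilbert_tensor_product t \<longleftrightarrow>
     (\<forall>x x' y. t (x + x') y = t x y + t x' y) \<and>
     (\<forall>x y y'. t x (y + y') = t x y + t x y') \<and>
     (\<forall>c x y. t (c *\<^sub>C x) y = c *\<^sub>C t x y) \<and>
     (\<forall>c x y. t x (c *\<^sub>C y) = c *\<^sub>C t x y) \<and>
     (\<forall>x y x' y'. cinner (t x y) (t x' y') = cinner x x' * cinner y y') \<and>
     closure (complex_vector.span {t x y |x y. True}) = UNIV"

definition tensor_op ::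
  "('h::complex_hilbert_space \<Rightarrow> 'k::complex_hilbert_space \<Rightarrow> 'hk::complex_hilbert_space) \<Rightarrow>
   ('h \<Rightarrow> 'h) \<Rightarrow> ('k \<Rightarrow> 'k) \<Rightarrow> 'hk \<Rightarrow> 'hk" where
  "tensor_op t S T = (THE W. bounded_clinear W \<and> (\<forall>x y. W (t x y) = t (S x) (T y)))"

section \<open>Measurement error and disturbance\<close>

definition noise_op ::
  "('h::complex_hilbert_space \<Rightarrow> 'k::complex_hilbert_space \<Rightarrow> 'hk::complex_hilbert_space) \<Rightarrow>
   ('hk \<Rightarrow> 'hk) \<Rightarrow> ('k \<Rightarrow> 'k) \<Rightarrow> ('h \<Rightarrow> 'h) \<Rightarrow> 'hk \<Rightarrow> 'hk" where
  "noise_op t U Aapp A =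
     (\<lambda>z. cadjoint U (tensor_op t id Aapp (U z)) - tensor_op t A id z)"

definition meas_error ::
  "('h::complex_hilbert_space \<Rightarrow> 'k::complex_hilbert_space \<Rightarrow> 'hk::complex_hilbert_space) \<Rightarrow>
   ('h \<Rightarrow> 'h) \<Rightarrow> ('k \<Rightarrow> 'k) \<Rightarrow> ('hk \<Rightarrow> 'hk) \<Rightarrow> ('k \<Rightarrow> 'k) \<Rightarrow> ('h \<Rightarrow> 'h) \<Rightarrow> real" where
  "meas_error t \<rho> \<rho>app U Aapp A =
     (let N = noise_op t U Aapp A in sqrt (Re (op_trace (tensor_op t \<rho> \<rho>app \<circ> (N \<circ> N)))))"

definition disturbance_op ::
  "('h::complex_hilbert_space \<Rightarrow> 'k::complex_hilbert_space \<Rightarrow> 'hk::complex_hilbert_space) \<Rightarrow>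
   ('hk \<Rightarrow> 'hk) \<Rightarrow> ('h \<Rightarrow> 'h) \<Rightarrow> 'hk \<Rightarrow> 'hk" where
  "disturbance_op t U B =
     (\<lambda>z. cadjoint U (tensor_op t B id (U z)) - tensor_op t B id z)"

definition disturbance ::
  "('h::complex_hilbert_space \<Rightarrow> 'k::complex_hilbert_space \<Rightarrow> 'hk::complex_hilbert_space) \<Rightarrow>
   ('h \<Rightarrow> 'h) \<Rightarrow> ('k \<Rightarrow> 'k) \<Rightarrow> ('hk \<Rightarrow> 'hk) \<Rightarrow> ('h \<Rightarrow> 'h) \<Rightarrow> real" where
  "disturbance t \<rho> \<rho>app U B =
     (let D = disturbance_op t U B in sqrt (Re (op_trace (tensor_op t \<rho> \<rho>app \<circ> (D \<circ> D)))))"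

end

theory Submission
  imports Defs
begin

text \<open>Both states are written as sums \<open>\<Sum> |v\<^sub>k\<rangle>\<langle>v\<^sub>k|\<close> of rank-one operators, by a Cholesky elimination along an
  orthonormal basis instead of the spectral theorem; traces against \<open>R = \<rho> \<otimes> \<rho>\<^sub>a\<^sub>p\<^sub>p\<close> then become sums
  over the family \<open>v\<^sub>k \<otimes> w\<^sub>j\<close>. With \<open>Z = X + isY\<close>, the sharpened Robertson relation for Hermitian
  \<open>X, Y\<close> amounts to \<open>l Tr(R Z Z\<^sup>*) \<le> L Tr(R Z\<^sup>* Z)\<close>, where \<open>l\<close> and \<open>L\<close> are the extremal eigenvalues of \<open>R\<close>.
  If one of the spaces is infinite-dimensional then \<open>l = 0\<close> and this is trivial; otherwise
  both sides compare to \<open>l L Tr(Z Z\<^sup>*)\<close>. Finally the meter and the evolved \<open>B\<close> commute,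
  so with the noise \<open>N\<close>, the disturbance \<open>D\<close> and the centered \<open>A, B\<close> we have
  \<open>[A, B] = -[N, D] - [N, B] - [A, D]\<close>, and the relation applies to each of the three terms.\<close>

section \<open>Positive sesquilinear forms and orthonormal bases\<close>

text \<open>\<open>abs_op\<close>, \<open>cadjoint\<close> and \<open>tensor_op\<close> are definite
  descriptions, and the tensor product is given only by a bilinear map with dense span. None of them
  says anything before existence and uniqueness are proved, and this shapes most of the development:
  reading \<open>trace_class\<close> off a state takes the uniqueness of positive square roots,
  \<open>A \<otimes> id\<close> takes a norm bound that comes from the Schur product theorem, and
  \<open>\<rho> \<otimes> \<sigma>\<close> is built from its vectors. Elimination uses only
  positivity and a finite trace, where a spectral decomposition would first need compactness of the
  state. Its vectors are not orthogonal in general, but traces only ask that their squared norms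
  have a finite sum. Over such a family a trace becomes a sum of terms
  \<open>cinner (X (v i)) (Y (v i))\<close>, so operator identities turn into identities for single
  vectors. Forms are treated abstractly because Cauchy-Schwarz, polarization and the Schur product
  are applied not only to \<open>cinner\<close> but also to \<open>cinner x (T y)\<close> and to
  differences of such forms.\<close>

locale positive_form =
  fixes F :: "'a::complex_hilbert_space \<Rightarrow> 'a \<Rightarrow> complex"
  assumes add_right: "F x (y + z) = F x y + F x z"
    and scaleC_right: "F x (c *\<^sub>C y) = c * F x y"
    and commute: "F x y = cnj (F y x)"
    and nonneg: "0 \<le> Re (F x x)"
begin

lemma add_left: "F (x + y) z = F x z + F y z"
  by (metis add_right commute complex_cnj_add)

lemma scaleC_left: "F (c *\<^sub>C x) y = cnj c * F x y"
  by (metis scaleC_right commute complex_cnj_mult)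

lemma zero_right [simp]: "F x 0 = 0"
  using add_right[of x 0 0] by simp

lemma zero_left [simp]: "F 0 x = 0"
  using add_left[of 0 0 x] by simp

lemma minus_right: "F x (- y) = - F x y"
  using add_right[of x y "- y"] by (simp add: add_eq_0_iff)

lemma minus_left: "F (- x) y = - F x y"
  using add_left[of x "- x" y] by (simp add: add_eq_0_iff)

lemma diff_right: "F x (y - z) = F x y - F x z"
  using add_right[of x y "- z"] by (simp add: minus_right)

lemma diff_left: "F (x - y) z = F x z - F y z"
  using add_left[of x "- y" z] by (simp add: minus_left)

lemma sum_right: "F x (\<Sum>i\<in>I. f i) = (\<Sum>i\<in>I. F x (f i))"
  by (induction I rule: infinite_finite_induct) (simp_all add: add_right)

lemma sum_left: "F (\<Sum>i\<in>I. f i) x = (\<Sum>i\<in>I. F (f i) x)"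
  by (induction I rule: infinite_finite_induct) (simp_all add: add_left)

lemma Im_self [simp]: "Im (F x x) = 0"
proof -
  have "Im (F x x) = Im (cnj (F x x))" using commute[of x x] by simp
  thus ?thesis by simp
qed

lemma self_eq: "F x x = complex_of_real (Re (F x x))"
  by (simp add: complex_eq_iff)

lemma cmod_commute: "cmod (F x y) = cmod (F y x)"
  by (metis commute complex_mod_cnj)

lemma Cauchy_Schwarz: "(cmod (F x y))\<^sup>2 \<le> Re (F x x) * Re (F y y)"
proof -
  define k where "k = (cmod (F x y))\<^sup>2"
  have k: "F x y * F y x = complex_of_real k" "F y x * F x y = complex_of_real k"
    using complex_norm_square[of "F x y"] commute[of y x] by (simp_all add: k_def mult.commute)
  \<comment> \<open>The coefficient carries the factor \<open>F y x\<close> so that both cross terms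
    become the real number \<open>k\<close>; what remains is a real quadratic polynomial in
    \<open>s\<close>.\<close>
  have *: "0 \<le> Re (F x x) - 2 * s * k + s\<^sup>2 * k * Re (F y y)" for s :: real
  proof -
    have "F (x - (of_real s * F y x) *\<^sub>C y) (x - (of_real s * F y x) *\<^sub>C y)
        = F x x - of_real s * (F y x * F x y) - of_real s * (cnj (F y x) * F y x)
          + (of_real s)\<^sup>2 * (cnj (F y x) * F y x) * F y y"
      by (simp add: diff_left diff_right scaleC_left scaleC_right algebra_simps power2_eq_square)
    also have "cnj (F y x) * F y x = of_real k"
      using k commute[of x y] by simp
    also have "F x x - of_real s * (F y x * F x y) - of_real s * of_real k
       + (of_real s)\<^sup>2 * of_real k * F y y
       = complex_of_real (Re (F x x) - 2 * s * k + s\<^sup>2 * k * Re (F y y))"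
      using k self_eq[of x] self_eq[of y] by (simp add: complex_eq_iff power2_eq_square)
    finally show ?thesis
      using nonneg[of "x - (of_real s * F y x) *\<^sub>C y"] by simp
  qed
  show ?thesis
  proof (cases "Re (F y y) = 0")
    case True
    have "k = 0"
    proof (rule ccontr)
      assume "k \<noteq> 0"
      \<comment> \<open>For \<open>F y y = 0\<close> the polynomial is affine in \<open>s\<close>;
        at this \<open>s\<close> it equals -1.\<close>
      with *[of "(Re (F x x) + 1) / (2 * k)"] True show False
        by simp
    qed
    then show ?thesis using True by (simp add: k_def)
  next
    case False
    hence pos: "0 < Re (F y y)" using nonneg[of y] by linarith
    have "0 \<le> Re (F x x) - k / Re (F y y)"
      using *[of "1 / Re (F y y)"] pos by (simp add: power2_eq_square field_simps)
    thus ?thesis using pos by (simp add: k_def field_simps)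
  qed
qed

lemma null_right: "Re (F y y) = 0 \<Longrightarrow> F x y = 0"
  using Cauchy_Schwarz[of x y] by simp

lemma parallelogram: "Re (F (x + y) (x + y)) \<le> 2 * Re (F x x) + 2 * Re (F y y)"
proof -
  have "Re (F (x + y) (x + y)) + Re (F (x - y) (x - y)) = 2 * Re (F x x) + 2 * Re (F y y)"
    by (simp add: add_left add_right diff_left diff_right)
  thus ?thesis using nonneg[of "x - y"] by linarith
qed

text \<open>Both sides are sesquilinear in \<open>x\<close> and \<open>y\<close>, so polarization
  lifts the diagonal case. A second form \<open>G\<close> is allowed: with \<open>G = cinner\<close>
  and \<open>F\<close> the form of an operator this gives rank-one expansions of the operator, and
  with \<open>F = G = cinner\<close> it gives Parseval.\<close>

lemma has_sum_polarization:
  assumes G: "positive_form G"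
    and diag: "\<And>x. ((\<lambda>i. (cmod (G (w i) x))\<^sup>2) has_sum Re (F x x)) I"
  shows "((\<lambda>i. G x (w i) * G (w i) y) has_sum F x y) I"
proof -
  interpret G: positive_form G by fact
  have d: "((\<lambda>i. G x (w i) * G (w i) x) has_sum F x x) I" for x
  proof -
    have "G x (w i) * G (w i) x = complex_of_real ((cmod (G (w i) x))\<^sup>2)" for i
      using complex_norm_square[of "G (w i) x"] G.commute[of x "w i"] by (simp add: mult.commute)
    moreover have "((\<lambda>i. complex_of_real ((cmod (G (w i) x))\<^sup>2)) has_sum of_real (Re (F x x))) I"
      by (rule has_sum_of_real[OF diag])
    ultimately show ?thesis using self_eq[of x] by simp
  qed
  \<comment> \<open>Stated for an arbitrary \<open>H\<close> because it is applied both to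
    \<open>F\<close> and to every summand \<open>?H i\<close>.\<close>
  have pol: "H (x + y) (x + y) + - H (x - y) (x - y)
       + (- \<i> * H (x + \<i> *\<^sub>C y) (x + \<i> *\<^sub>C y)) + \<i> * H (x - \<i> *\<^sub>C y) (x - \<i> *\<^sub>C y) = 4 * H x y"
    if "\<And>x y z. H (x + y) z = H x z + H y z" "\<And>x y z. H x (y + z) = H x y + H x z"
       "\<And>x y z. H (x - y) z = H x z - H y z" "\<And>x y z. H x (y - z) = H x y - H x z"
       "\<And>c x y. H (c *\<^sub>C x) y = cnj c * H x y" "\<And>c x y. H x (c *\<^sub>C y) = c * H x y"
    for H :: "'a \<Rightarrow> 'a \<Rightarrow> complex"
    by (simp add: that algebra_simps)
  let ?H = "\<lambda>i x y. G x (w i) * G (w i) y"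
  have "((\<lambda>i. ?H i (x + y) (x + y) + - ?H i (x - y) (x - y)
       + (- \<i> * ?H i (x + \<i> *\<^sub>C y) (x + \<i> *\<^sub>C y)) + \<i> * ?H i (x - \<i> *\<^sub>C y) (x - \<i> *\<^sub>C y))
     has_sum (F (x + y) (x + y) + - F (x - y) (x - y)
       + (- \<i> * F (x + \<i> *\<^sub>C y) (x + \<i> *\<^sub>C y)) + \<i> * F (x - \<i> *\<^sub>C y) (x - \<i> *\<^sub>C y))) I"
    by (intro has_sum_add has_sum_uminusI has_sum_cmult_right d)
  moreover have "?H i (x + y) (x + y) + - ?H i (x - y) (x - y)
       + (- \<i> * ?H i (x + \<i> *\<^sub>C y) (x + \<i> *\<^sub>C y)) + \<i> * ?H i (x - \<i> *\<^sub>C y) (x - \<i> *\<^sub>C y)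
     = 4 * ?H i x y" for i
    by (rule pol[of "?H i"]) (simp_all add: G.add_left G.add_right G.diff_left G.diff_right G.scaleC_left G.scaleC_right
        algebra_simps)
  moreover have "F (x + y) (x + y) + - F (x - y) (x - y)
       + (- \<i> * F (x + \<i> *\<^sub>C y) (x + \<i> *\<^sub>C y)) + \<i> * F (x - \<i> *\<^sub>C y) (x - \<i> *\<^sub>C y)
     = 4 * F x y"
    by (rule pol[of F]) (simp_all add: add_left add_right diff_left diff_right scaleC_left scaleC_right)
  ultimately have "((\<lambda>i. 4 * ?H i x y) has_sum (4 * F x y)) I" by simp
  from has_sum_cmult_right[OF this, of "1/4"] show ?thesis by simp
qed

end

interpretation cinner: positive_form cinner
  by unfold_locales
    (auto simp: cinner_add_right cinner_scaleC_right cinner_norm intro: cinner_commute)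

section \<open>Norm and inner product\<close>

lemma Re_cinner_self [simp]: "Re (cinner x x) = (norm x)\<^sup>2"
  by (simp add: cinner_norm)

lemma cinner_Cauchy_Schwarz: "cmod (cinner x y) \<le> norm x * norm y"
proof -
  have "(cmod (cinner x y))\<^sup>2 \<le> (norm x * norm y)\<^sup>2"
    using cinner.Cauchy_Schwarz[of x y] by (simp add: power_mult_distrib)
  thus ?thesis by (rule power2_le_imp_le) simp
qed

lemma cinner_ext: "(\<And>z. cinner z x = cinner z y) \<Longrightarrow> x = y"
proof -
  assume "\<And>z. cinner z x = cinner z y"
  hence "cinner (x - y) (x - y) = 0" by (simp add: cinner.diff_right)
  thus "x = y" by (simp add: cinner_norm)
qed

lemma norm_scaleC: "norm (c *\<^sub>C x) = cmod c * norm x"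
proof -
  have "cinner (c *\<^sub>C x) (c *\<^sub>C x) = of_real ((cmod c)\<^sup>2 * (norm x)\<^sup>2)"
    by (simp add: cinner.scaleC_left cinner.scaleC_right cinner_norm[of x]
        complex_norm_square[symmetric])
  hence "(norm (c *\<^sub>C x))\<^sup>2 = (cmod c * norm x)\<^sup>2"
    unfolding cinner_norm by (metis of_real_eq_iff power_mult_distrib)
  thus ?thesis by (simp add: power2_eq_iff_nonneg)
qed

lemma bounded_bilinear_cinner: "bounded_bilinear cinner"
proof
  show "cinner (r *\<^sub>R x) y = r *\<^sub>R cinner x y" "cinner x (r *\<^sub>R y) = r *\<^sub>R cinner x y" for r x y
    by (simp_all add: scaleR_scaleC cinner.scaleC_left cinner.scaleC_right scaleR_conv_of_real)
  show "\<exists>K. \<forall>x y. norm (cinner x y) \<le> norm x * norm y * K"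
    by (intro exI[of _ 1]) (simp add: cinner_Cauchy_Schwarz)
qed (simp_all add: cinner.add_left cinner.add_right)

lemmas bounded_linear_cinner_right = bounded_bilinear.bounded_linear_right[OF bounded_bilinear_cinner]

lemmas continuous_on_cinner [continuous_intros] =
  bounded_bilinear.continuous_on[OF bounded_bilinear_cinner]

section \<open>Bounded operators\<close>

lemma bounded_clinearD:
  assumes "bounded_clinear T"
  shows "T (x + y) = T x + T y" "T (c *\<^sub>C x) = c *\<^sub>C T x"
  using assms by (auto simp: bounded_clinear_def)

lemma bounded_clinear_imp_bounded_linear: "bounded_clinear T \<Longrightarrow> bounded_linear T"
  unfolding bounded_clinear_def
  by (metis (no_types, lifting) bounded_linear_intro scaleR_scaleC)

lemma bounded_clinear_bound:
  assumes "bounded_clinear T"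
  obtains K where "0 < K" "\<And>x. norm (T x) \<le> K * norm x"
  using bounded_linear.pos_bounded[OF bounded_clinear_imp_bounded_linear[OF assms]]
  by (metis mult.commute)

lemma bounded_clinear_simps:
  assumes "bounded_clinear T"
  shows "T 0 = 0" "T (x - y) = T x - T y" "T (- x) = - T x" "T (\<Sum>i\<in>I. f i) = (\<Sum>i\<in>I. T (f i))"
  using bounded_clinear_imp_bounded_linear[OF assms]
  by (simp_all add: linear_0 linear_diff linear_neg linear_sum bounded_linear.linear)

lemma bounded_clinear_continuous_on: "bounded_clinear T \<Longrightarrow> continuous_on S T"
  by (simp add: bounded_clinear_imp_bounded_linear linear_continuous_on)

lemma bounded_clinear_compose:
  assumes "bounded_clinear S" "bounded_clinear T"
  shows "bounded_clinear (\<lambda>x. S (T x))"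
proof -
  obtain K L where *: "0 < K" "\<And>x. norm (S x) \<le> K * norm x" "0 < L" "\<And>x. norm (T x) \<le> L * norm x"
    using assms by (metis bounded_clinear_bound)
  have "norm (S (T x)) \<le> norm x * (K * L)" for x
  proof -
    have "norm (S (T x)) \<le> K * (L * norm x)"
      using * by (meson less_imp_le mult_left_mono order_trans)
    thus ?thesis by (simp add: mult_ac)
  qed
  thus ?thesis unfolding bounded_clinear_def using assms by (auto simp: bounded_clinearD)
qed

lemma bounded_clinear_diff:
  assumes "bounded_clinear S" "bounded_clinear T"
  shows "bounded_clinear (\<lambda>x. S x - T x)"
proof -
  obtain K L where *: "\<And>x. norm (S x) \<le> K * norm x" "\<And>x. norm (T x) \<le> L * norm x"
    using assms by (metis bounded_clinear_bound)
  have "norm (S x - T x) \<le> norm x * (K + L)" for x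
    using norm_triangle_ineq4[of "S x" "T x"] *[of x] by (simp add: algebra_simps)
  thus ?thesis unfolding bounded_clinear_def using assms
    by (auto simp: bounded_clinearD complex_vector.scale_right_diff_distrib)
qed

lemma bounded_clinear_scaleC: "bounded_clinear (\<lambda>x. c *\<^sub>C x)"
  unfolding bounded_clinear_def
  by (auto simp: scaleC_add_right scaleC_scaleC norm_scaleC mult.commute intro!: exI[of _ "cmod c"])

lemma bounded_clinear_id: "bounded_clinear id"
  unfolding bounded_clinear_def by (auto intro!: exI[of _ 1])

text \<open>On a complex space a real quadratic form is symmetric: its values at
  \<open>x + y\<close> and at \<open>x + \<i> *\<^sub>C y\<close> control the imaginary and the real
  part of the defect.\<close>

lemma positive_op_form:
  assumes "positive_op T"
  shows "positive_form (\<lambda>x y. cinner x (T y))"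
proof -
  note T = bounded_clinearD[OF assms[unfolded positive_op_def, THEN conjunct1]]
  have "Re (cinner x (T x)) \<ge> 0" "Im (cinner x (T x)) = 0" for x
    using assms by (auto simp: positive_op_def complex_nonneg_Reals_iff)
  note nn = this
  have comm: "cinner x (T y) = cnj (cinner y (T x))" for x y
  proof -
    have "Im (cinner (x + y) (T (x + y))) = 0" "Im (cinner (x + \<i> *\<^sub>C y) (T (x + \<i> *\<^sub>C y))) = 0"
      by (rule nn)+
    thus ?thesis using nn[of x] nn[of y]
      by (simp add: T cinner.add_left cinner.add_right cinner.scaleC_left cinner.scaleC_right
          complex_eq_iff)
  qed
  show ?thesis
    by unfold_locales (simp_all add: T cinner.add_right cinner.scaleC_right nn, rule comm)
qed

lemma positive_op_iff:
  "positive_op T \<longleftrightarrow> hermitian T \<and> (\<forall>x. 0 \<le> Re (cinner x (T x)))"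
proof
  assume T: "positive_op T"
  interpret positive_form "\<lambda>x y. cinner x (T y)" by (rule positive_op_form[OF T])
  have "cinner (T x) y = cinner x (T y)" for x y
    using cinner_commute[of "T x" y] commute[of x y] by simp
  thus "hermitian T \<and> (\<forall>x. 0 \<le> Re (cinner x (T x)))"
    using T nonneg by (auto simp: hermitian_def positive_op_def)
next
  assume T: "hermitian T \<and> (\<forall>x. 0 \<le> Re (cinner x (T x)))"
  have "Im (cinner x (T x)) = 0" for x
  proof -
    have "cinner x (T x) = cnj (cinner x (T x))"
      using T cinner_commute[of x "T x"] by (simp add: hermitian_def)
    thus ?thesis by (metis Im_complex_of_real Reals_cnj_iff Reals_cases)
  qed
  thus "positive_op T" using T
    by (auto simp: positive_op_def hermitian_def complex_nonneg_Reals_iff)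
qed

lemma hermitian_Im_self [simp]: "hermitian T \<Longrightarrow> Im (cinner (T x) x) = 0"
proof -
  assume "hermitian T"
  hence "cinner (T x) x = cnj (cinner (T x) x)"
    using cinner_commute[of "T x" x] by (simp add: hermitian_def)
  thus ?thesis by (metis Im_complex_of_real Reals_cnj_iff Reals_cases)
qed

text \<open>Cauchy-Schwarz for the form of \<open>T\<close> at the pair \<open>T x\<close>,
  \<open>x\<close>. The constant is that of the quadratic form itself, and a vector at which the
  form vanishes lies in the kernel of \<open>T\<close>.\<close>

lemma positive_op_norm_le:
  assumes T: "positive_op T" and C: "\<And>x. Re (cinner x (T x)) \<le> C * (norm x)\<^sup>2"
  shows "(norm (T x))\<^sup>2 \<le> C * Re (cinner x (T x))"
proof (cases "T x = 0")
  case False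
  interpret positive_form "\<lambda>x y. cinner x (T y)" by (rule positive_op_form[OF T])
  have "(norm (T x))\<^sup>2 * (norm (T x))\<^sup>2 = (cmod (cinner (T x) (T x)))\<^sup>2"
    unfolding cinner_norm norm_of_real by (simp add: power2_eq_square)
  also have "\<dots> \<le> Re (cinner (T x) (T (T x))) * Re (cinner x (T x))"
    by (rule Cauchy_Schwarz)
  also have "\<dots> \<le> (C * (norm (T x))\<^sup>2) * Re (cinner x (T x))"
    by (intro mult_right_mono C nonneg)
  finally have "(norm (T x))\<^sup>2 * (norm (T x))\<^sup>2 \<le> (norm (T x))\<^sup>2 * (C * Re (cinner x (T x)))"
    by (simp only: mult_ac)
  moreover have "0 < (norm (T x))\<^sup>2" using False by simp
  ultimately show ?thesis by (rule mult_left_le_imp_le)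
qed simp

lemma positive_op_bound:
  assumes T: "positive_op T"
  obtains C where "0 < C" "\<And>x. Re (cinner x (T x)) \<le> C * (norm x)\<^sup>2"
    "\<And>x. (norm (T x))\<^sup>2 \<le> C * Re (cinner x (T x))"
proof -
  obtain C where C: "0 < C" "\<And>x. norm (T x) \<le> C * norm x"
    using T bounded_clinear_bound by (metis positive_op_def)
  have "Re (cinner x (T x)) \<le> C * (norm x)\<^sup>2" for x
  proof -
    have "Re (cinner x (T x)) \<le> norm x * norm (T x)"
      using complex_Re_le_cmod cinner_Cauchy_Schwarz order_trans by blast
    also have "\<dots> \<le> norm x * (C * norm x)" by (simp add: C mult_left_mono)
    finally show ?thesis by (simp add: power2_eq_square mult_ac)
  qed
  thus ?thesis using that C(1) positive_op_norm_le[OF T] by blast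
qed

section \<open>Density arguments and Parseval's identity\<close>

lemma dense_span_induct [consumes 1, case_names closed base step]:
  assumes "closure (complex_vector.span S) = UNIV"
    and "closed {z. P z}" and "P 0" and "\<And>c b z. b \<in> S \<Longrightarrow> P z \<Longrightarrow> P (c *\<^sub>C b + z)"
  shows "P z"
proof -
  have "P z" if "z \<in> complex_vector.span S" for z
    using that by (induction rule: complex_vector.span_induct_alt) (auto intro: assms)
  hence "closure (complex_vector.span S) \<subseteq> {z. P z}"
    by (intro closure_minimal assms(2)) auto
  thus ?thesis using assms(1) by auto
qed

lemma dense_span_cinner_ext:
  assumes "closure (complex_vector.span S) = UNIV"
    and "\<And>z. z \<in> S \<Longrightarrow> cinner z x = cinner z y"
  shows "x = y"
proof (rule cinner_ext)
  fix z show "cinner z x = cinner z y"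
    using assms(1)
    by (induction z rule: dense_span_induct)
      (auto simp: assms(2) cinner.add_left cinner.scaleC_left intro!: closed_Collect_eq continuous_intros)
qed

lemma dense_span_ext:
  assumes "closure (complex_vector.span S) = UNIV"
    and "bounded_clinear V" "bounded_clinear W" "\<And>z. z \<in> S \<Longrightarrow> V z = W z"
  shows "V = W"
proof
  fix z show "V z = W z"
    using assms(1)
    by (induction z rule: dense_span_induct)
      (auto simp: assms(4) bounded_clinearD[OF assms(2)] bounded_clinearD[OF assms(3)]
          bounded_clinear_simps[OF assms(2)] bounded_clinear_simps[OF assms(3)]
        intro!: closed_Collect_eq bounded_clinear_continuous_on assms)
qed

text \<open>Pythagoras with a completed square. This one identity gives Bessel (for
  \<open>c e = cinner e x\<close>), Parseval, finite expansions and, at \<open>x = 0\<close>, linear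
  independence.\<close>

lemma finite_onb_distance:
  assumes "is_onb E" "finite F" "F \<subseteq> E"
  shows "(norm (x - (\<Sum>e\<in>F. c e *\<^sub>C e)))\<^sup>2
    = (norm x)\<^sup>2 - (\<Sum>e\<in>F. (cmod (cinner e x))\<^sup>2) + (\<Sum>e\<in>F. (cmod (cinner e x - c e))\<^sup>2)"
proof -
  let ?s = "\<Sum>e\<in>F. c e *\<^sub>C e"
  have on: "cinner e f = (if e = f then 1 else 0)" if "e \<in> F" "f \<in> F" for e f
    using assms(1,3) that unfolding is_onb_def by (metis cinner_norm of_real_1 one_power2 subsetD)
  have xs: "cinner x ?s = (\<Sum>e\<in>F. c e * cnj (cinner e x))"
    by (simp add: cinner.sum_right cinner.scaleC_right cinner_commute[symmetric])
  have sx: "cinner ?s x = (\<Sum>e\<in>F. cnj (c e) * cinner e x)"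
    by (simp add: cinner.sum_left cinner.scaleC_left)
  have "cinner ?s ?s = (\<Sum>e\<in>F. \<Sum>f\<in>F. cnj (c e) * c f * cinner e f)"
    by (simp only: cinner.sum_left cinner.scaleC_left)
      (simp add: cinner.sum_right cinner.scaleC_right sum_distrib_left mult_ac)
  also have "\<dots> = (\<Sum>e\<in>F. \<Sum>f\<in>F. if e = f then cnj (c e) * c f else 0)"
    by (intro sum.cong refl) (simp add: on)
  also have "\<dots> = (\<Sum>e\<in>F. cnj (c e) * c e)"
    using assms(2) by simp
  finally have ss: "cinner ?s ?s = (\<Sum>e\<in>F. cnj (c e) * c e)" .
  have "cinner (x - ?s) (x - ?s) = cinner x x
     + (\<Sum>e\<in>F. cnj (c e) * c e - cnj (c e) * cinner e x - c e * cnj (cinner e x))"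
    by (simp add: cinner.diff_left cinner.diff_right xs sx ss sum_subtractf)
  also have "\<dots> = cinner x x + (\<Sum>e\<in>F. of_real ((cmod (cinner e x - c e))\<^sup>2 - (cmod (cinner e x))\<^sup>2))"
    by (intro arg_cong2[of _ _ _ _ "(+)"] refl sum.cong)
      (simp only: of_real_diff complex_norm_square, simp add: algebra_simps)
  finally have "Re (cinner (x - ?s) (x - ?s)) = Re \<dots>" by simp
  thus ?thesis by (simp add: sum_subtractf)
qed

lemma onb_Parseval_diag:
  assumes E: "is_onb E"
  shows "((\<lambda>e. (cmod (cinner e x))\<^sup>2) has_sum (norm x)\<^sup>2) E"
proof -
  let ?f = "\<lambda>e. (cmod (cinner e x))\<^sup>2"
  have Bessel: "sum ?f F \<le> (norm x)\<^sup>2" if "finite F" "F \<subseteq> E" for F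
    using finite_onb_distance[OF E that, of x "\<lambda>e. cinner e x"]
      zero_le_power2[of "norm (x - (\<Sum>e\<in>F. cinner e x *\<^sub>C e))"] by simp
  have summ: "?f summable_on E"
    by (rule nonneg_bounded_partial_sums_imp_summable_on[of _ _ "(norm x)\<^sup>2"])
      (auto intro!: eventually_finite_subsets_at_top_weakI Bessel)
  have "infsum ?f E \<le> (norm x)\<^sup>2"
    by (rule infsum_le_finite_sums[OF summ]) (auto intro: Bessel)
  moreover have "(norm x)\<^sup>2 \<le> infsum ?f E"
  proof (rule field_le_epsilon)
    fix \<epsilon> :: real assume "0 < \<epsilon>"
    hence "x \<in> closure (complex_vector.span E)" "0 < sqrt \<epsilon>" using E by (auto simp: is_onb_def)
    then obtain s where s: "s \<in> complex_vector.span E" "dist s x < sqrt \<epsilon>"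
      unfolding closure_approachable by blast
    then obtain F c where F: "finite F" "F \<subseteq> E" "s = (\<Sum>e\<in>F. c e *\<^sub>C e)"
      unfolding complex_vector.span_explicit by blast
    have "(norm (x - s))\<^sup>2 \<le> (sqrt \<epsilon>)\<^sup>2"
      using s(2) by (intro power_mono) (auto simp: dist_norm norm_minus_commute)
    \<comment> \<open>The Fourier coefficients approximate at least as well as the
      \<open>c e\<close>: the last sum of the distance formula is dropped.\<close>
    hence "(norm x)\<^sup>2 - sum ?f F \<le> \<epsilon>"
      using finite_onb_distance[OF E F(1,2), of x c] \<open>0 < \<epsilon>\<close> F(3)
        sum_nonneg[of F "\<lambda>e. (cmod (cinner e x - c e))\<^sup>2"] by simp
    moreover have "sum ?f F \<le> infsum ?f E"
      by (rule finite_sum_le_infsum[OF summ F(1,2)]) simp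
    ultimately show "(norm x)\<^sup>2 \<le> infsum ?f E + \<epsilon>" by linarith
  qed
  ultimately show ?thesis using summ by (simp add: has_sum_iff)
qed

lemma onb_Parseval:
  assumes "is_onb E"
  shows "((\<lambda>e. cinner x e * cinner e y) has_sum cinner x y) E"
  by (rule cinner.has_sum_polarization[OF cinner.positive_form_axioms])
    (simp add: onb_Parseval_diag[OF assms])

section \<open>States as sums of rank-one operators\<close>

lemma cadjoint_eqI:
  assumes "\<And>x y. cinner (S x) y = cinner x (T y)"
  shows "cadjoint T = S"
  unfolding cadjoint_def
proof (rule the_equality)
  show "\<forall>x y. cinner (S x) y = cinner x (T y)" using assms by simp
next
  fix S' assume *: "\<forall>x y. cinner (S' x) y = cinner x (T y)"
  show "S' = S"
  proof
    fix x
    have "cinner z (S' x) = cinner z (S x)" for z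
      using * assms by (metis cinner_commute)
    thus "S' x = S x" by (rule cinner_ext)
  qed
qed

text \<open>Expand the square and use \<open>norm (D (D x)) \<le> s * norm (D x)\<close>. Unit
  vectors that nearly attain the norm \<open>s\<close> are therefore approximate eigenvectors of
  \<open>D \<circ> D\<close> for \<open>s\<^sup>2\<close>.\<close>

lemma hermitian_diff_approx_eigenvector:
  assumes D: "hermitian D" and bd: "\<And>x. norm (D x) \<le> s * norm x" and "0 \<le> s"
  shows "norm (D (D x) - complex_of_real (s\<^sup>2) *\<^sub>C x) \<le> s * sqrt (s\<^sup>2 * (norm x)\<^sup>2 - (norm (D x))\<^sup>2)"
proof -
  have sym: "cinner (D (D x)) x = cinner (D x) (D x)" "cinner x (D (D x)) = cinner (D x) (D x)"
    using D by (auto simp: hermitian_def)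
  have "(norm (D (D x) - complex_of_real (s\<^sup>2) *\<^sub>C x))\<^sup>2
      = (norm (D (D x)))\<^sup>2 - 2 * s\<^sup>2 * (norm (D x))\<^sup>2 + s ^ 4 * (norm x)\<^sup>2"
    unfolding Re_cinner_self[symmetric]
    by (simp add: cinner.diff_left cinner.diff_right cinner.scaleC_left cinner.scaleC_right sym)
      (simp add: cinner_norm algebra_simps power2_eq_square power4_eq_xxxx)
  also have "(norm (D (D x)))\<^sup>2 \<le> (s * norm (D x))\<^sup>2"
    by (intro power_mono bd) simp
  finally have "(norm (D (D x) - complex_of_real (s\<^sup>2) *\<^sub>C x))\<^sup>2
      \<le> s\<^sup>2 * (s\<^sup>2 * (norm x)\<^sup>2 - (norm (D x))\<^sup>2)"
    by (simp add: power_mult_distrib algebra_simps power2_eq_square power4_eq_xxxx)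
  from real_sqrt_le_mono[OF this] show ?thesis using \<open>0 \<le> s\<close> by (simp add: real_sqrt_mult)
qed

text \<open>If \<open>D = P - Q\<close> with \<open>P\<^sup>2 = Q\<^sup>2\<close>, then \<open>PD + DP = D\<^sup>2 = -(QD + DQ)\<close>, so positivity of \<open>P\<close> and \<open>Q\<close>
  excludes negative and positive approximate eigenvalues of \<open>D\<close>; but one of \<open>\<plusminus>\<parallel>D\<parallel>\<close> is one.\<close>

lemma positive_sqrt_unique:
  assumes P: "positive_op P" and Q: "positive_op Q" and eq: "\<And>x. P (P x) = Q (Q x)"
  shows "P = Q"
proof (rule ccontr)
  assume "P \<noteq> Q"
  define D where "D = (\<lambda>x. P x - Q x)"
  have hP: "hermitian P" and hQ: "hermitian Q" using P Q by (auto simp: positive_op_iff)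
  hence blD: "bounded_clinear D"
    unfolding D_def by (intro bounded_clinear_diff) (auto simp: hermitian_def)
  have hD: "hermitian D"
    using hP hQ blD by (auto simp: hermitian_def D_def cinner.diff_left cinner.diff_right)
  \<comment> \<open>Since \<open>P\<close> and \<open>Q\<close> have equal squares,
    \<open>P x\<close> and \<open>Q x\<close> have equal norms; expand
    \<open>P x = Q x + D x\<close> and \<open>Q x = P x - D x\<close>.\<close>
  have DQ: "2 * Re (cinner (Q x) (D x)) = - (norm (D x))\<^sup>2"
    and DP: "2 * Re (cinner (P x) (D x)) = (norm (D x))\<^sup>2" for x
  proof -
    have n: "(norm (P x))\<^sup>2 = (norm (Q x))\<^sup>2"
      unfolding Re_cinner_self[symmetric] using hP hQ eq by (metis hermitian_def)
    have "(norm (P x))\<^sup>2 = (norm (Q x))\<^sup>2 + 2 * Re (cinner (Q x) (D x)) + (norm (D x))\<^sup>2"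
      unfolding Re_cinner_self[symmetric] D_def
      using cinner_commute[of "P x" "Q x"]
      by (simp add: cinner.diff_left cinner.diff_right)
    thus "2 * Re (cinner (Q x) (D x)) = - (norm (D x))\<^sup>2" using n by simp
    have "(norm (Q x))\<^sup>2 = (norm (P x))\<^sup>2 - 2 * Re (cinner (P x) (D x)) + (norm (D x))\<^sup>2"
      unfolding Re_cinner_self[symmetric] D_def
      using cinner_commute[of "P x" "Q x"]
      by (simp add: cinner.diff_left cinner.diff_right)
    thus "2 * Re (cinner (P x) (D x)) = (norm (D x))\<^sup>2" using n by simp
  qed
  obtain K where K: "0 < K" "\<And>x. norm (P x) \<le> K * norm x"
    using P bounded_clinear_bound by (metis positive_op_def)
  obtain L where L: "0 < L" "\<And>x. norm (Q x) \<le> L * norm x"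
    using Q bounded_clinear_bound by (metis positive_op_def)
  define s where "s = onorm D"
  have blD': "bounded_linear D" by (rule bounded_clinear_imp_bounded_linear[OF blD])
  have s_pos: "0 < s"
    unfolding s_def using \<open>P \<noteq> Q\<close> by (subst onorm_pos_lt[OF blD']) (auto simp: D_def)
  have bd: "norm (D x) \<le> s * norm x" for x
    unfolding s_def by (rule onorm[OF blD'])
  \<comment> \<open>If \<open>D x\<close> is close to \<open>s\<close> times \<open>x\<close>, the
    inner product in \<open>DQ\<close> is close to a nonnegative number, yet \<open>DQ\<close> makes
    it negative unless \<open>D x = 0\<close>. This is the quantitative form; \<open>lower\<close>
    is its mirror image for \<open>- s\<close>.\<close>
  have upper: "(norm (D x))\<^sup>2 \<le> 2 * L * norm x * norm (D x - complex_of_real s *\<^sub>C x)" for x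
  proof -
    define r where "r = D x - complex_of_real s *\<^sub>C x"
    have "cinner (Q x) (D x) = of_real s * cinner (Q x) x + cinner (Q x) r"
      by (simp add: r_def cinner.diff_right cinner.scaleC_right)
    hence "- (norm (D x))\<^sup>2 = 2 * s * Re (cinner (Q x) x) + 2 * Re (cinner (Q x) r)"
      using DQ[of x] by simp
    moreover have "0 \<le> s * Re (cinner (Q x) x)"
      using Q s_pos by (auto simp: positive_op_iff hermitian_def)
    moreover have "- Re (cinner (Q x) r) \<le> norm (Q x) * norm r"
      using abs_Re_le_cmod[of "cinner (Q x) r"] cinner_Cauchy_Schwarz[of "Q x" r] by linarith
    moreover have "norm (Q x) * norm r \<le> L * norm x * norm r"
      by (intro mult_right_mono L) simp
    ultimately show ?thesis unfolding r_def[symmetric] by linarith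
  qed
  have lower: "(norm (D x))\<^sup>2 \<le> 2 * K * norm x * norm (D x + complex_of_real s *\<^sub>C x)" for x
  proof -
    define r where "r = D x + complex_of_real s *\<^sub>C x"
    have "D x = r - complex_of_real s *\<^sub>C x" by (simp add: r_def)
    hence "cinner (P x) (D x) = cinner (P x) r - of_real s * cinner (P x) x"
      by (simp add: cinner.diff_right cinner.scaleC_right)
    hence "(norm (D x))\<^sup>2 = 2 * Re (cinner (P x) r) - 2 * s * Re (cinner (P x) x)"
      using DP[of x] by simp
    moreover have "0 \<le> s * Re (cinner (P x) x)"
      using P s_pos by (auto simp: positive_op_iff hermitian_def)
    moreover have "Re (cinner (P x) r) \<le> norm (P x) * norm r"
      using abs_Re_le_cmod[of "cinner (P x) r"] cinner_Cauchy_Schwarz[of "P x" r] by linarith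
    moreover have "norm (P x) * norm r \<le> K * norm x * norm r"
      by (intro mult_right_mono K) simp
    ultimately show ?thesis unfolding r_def[symmetric] by linarith
  qed
  have "\<exists>x. norm x = 1 \<and> s - 1 / real (Suc n) < norm (D x)" for n
  proof (rule ccontr)
    assume "\<not> ?thesis"
    hence *: "norm (D x) \<le> s - 1 / real (Suc n)" if "norm x = 1" for x using that by force
    obtain z where "P z \<noteq> Q z" using \<open>P \<noteq> Q\<close> by blast
    hence "z \<noteq> 0" using bounded_clinear_simps(1)[OF blD] by (auto simp: D_def)
    hence "norm (z /\<^sub>R norm z) = 1" by simp
    hence "0 \<le> s - 1 / real (Suc n)" using *[of "z /\<^sub>R norm z"] norm_ge_zero order_trans by blast
    hence "onorm D \<le> s - 1 / real (Suc n)"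
    proof (rule onorm_bound)
      fix x
      show "norm (D x) \<le> (s - 1 / real (Suc n)) * norm x"
      proof (cases "x = 0")
        case False
        have "norm (D (x /\<^sub>R norm x)) \<le> s - 1 / real (Suc n)"
          by (rule *) (use False in simp)
        thus ?thesis
          using False by (simp add: linear_scale[OF bounded_linear.linear[OF blD']] field_simps)
      qed (simp add: bounded_clinear_simps[OF blD])
    qed
    thus False by (simp add: s_def)
  qed
  then obtain x where x: "\<And>n. norm (x n) = 1" "\<And>n. s - 1 / real (Suc n) < norm (D (x n))"
    by metis
  have lim1: "(\<lambda>n. norm (D (x n))) \<longlonglongrightarrow> s"
  proof (rule tendsto_sandwich)
    show "\<forall>\<^sub>F n in sequentially. s - 1 / real (Suc n) \<le> norm (D (x n))"
      by (intro always_eventually allI less_imp_le x(2))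
    show "\<forall>\<^sub>F n in sequentially. norm (D (x n)) \<le> s"
      using bd[of "x _"] x(1) by simp
    show "(\<lambda>n. s - 1 / real (Suc n)) \<longlonglongrightarrow> s"
      using tendsto_diff[OF tendsto_const[of s] LIMSEQ_Suc[OF lim_1_over_n]] by simp
  qed simp
  define \<delta> where "\<delta> n = s * sqrt (s\<^sup>2 - (norm (D (x n)))\<^sup>2)" for n
  have "\<delta> \<longlonglongrightarrow> s * sqrt (s\<^sup>2 - s\<^sup>2)"
    unfolding \<delta>_def by (intro tendsto_intros lim1)
  hence \<delta>: "\<delta> \<longlonglongrightarrow> 0" by simp
  \<comment> \<open>Because \<open>(D - s) (D + s) = D\<^sup>2 - s\<^sup>2\<close>, the
    \<open>y n\<close> satisfy the eigenvalue equation for \<open>s\<close> up to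
    \<open>\<delta> n\<close>. By \<open>upper\<close> they tend to 0, which makes the
    \<open>x n\<close> approximate eigenvectors for \<open>- s\<close>, and \<open>lower\<close>
    excludes those.\<close>
  define y where "y n = D (x n) + complex_of_real s *\<^sub>C x n" for n
  have Dy: "norm (D (y n) - complex_of_real s *\<^sub>C y n) \<le> \<delta> n" for n
    using hermitian_diff_approx_eigenvector[OF hD bd less_imp_le[OF s_pos], of "x n"] x(1)[of n]
    by (simp add: y_def \<delta>_def bounded_clinearD[OF blD] scaleC_add_right scaleC_scaleC
        power2_eq_square)
  have ny: "norm (y n) \<le> 2 * s" for n
    using norm_triangle_ineq[of "D (x n)" "complex_of_real s *\<^sub>C x n"] bd[of "x n"] x(1)[of n] s_pos
    by (simp add: y_def norm_scaleC)
  have "(norm (D (y n)))\<^sup>2 \<le> 2 * L * (2 * s) * \<delta> n" for n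
  proof -
    have "2 * L * norm (y n) * norm (D (y n) - complex_of_real s *\<^sub>C y n) \<le> 2 * L * (2 * s) * \<delta> n"
      using L s_pos ny Dy by (intro mult_mono mult_left_mono) auto
    thus ?thesis using upper[of "y n"] by linarith
  qed
  moreover have "(\<lambda>n. 2 * L * (2 * s) * \<delta> n) \<longlonglongrightarrow> 0"
    by (rule tendsto_mult_right_zero[OF \<delta>])
  ultimately have "(\<lambda>n. (norm (D (y n)))\<^sup>2) \<longlonglongrightarrow> 0"
    by (rule_tac tendsto_sandwich[OF _ _ tendsto_const]) auto
  hence "(\<lambda>n. sqrt ((norm (D (y n)))\<^sup>2)) \<longlonglongrightarrow> sqrt 0" by (rule tendsto_real_sqrt)
  hence "(\<lambda>n. norm (D (y n))) \<longlonglongrightarrow> 0" by simp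
  from tendsto_add[OF this \<delta>] have "(\<lambda>n. norm (D (y n)) + \<delta> n) \<longlonglongrightarrow> 0" by simp
  moreover have "s * norm (y n) \<le> norm (D (y n)) + \<delta> n" for n
    using norm_triangle_ineq2[of "complex_of_real s *\<^sub>C y n" "D (y n)"] Dy[of n] s_pos
    by (simp add: norm_scaleC norm_minus_commute)
  ultimately have "(\<lambda>n. s * norm (y n)) \<longlonglongrightarrow> 0"
    by (rule_tac tendsto_sandwich[OF _ _ tendsto_const]) (use s_pos in auto)
  from tendsto_mult_right_zero[OF this, of "2 * K / s"]
  have "(\<lambda>n. 2 * K * norm (y n)) \<longlonglongrightarrow> 0" using s_pos by (simp add: mult_ac)
  moreover have "(norm (D (x n)))\<^sup>2 \<le> 2 * K * norm (y n)" for n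
    using lower[of "x n"] x(1)[of n] by (simp add: y_def)
  ultimately have "(\<lambda>n. (norm (D (x n)))\<^sup>2) \<longlonglongrightarrow> 0"
    by (rule_tac tendsto_sandwich[OF _ _ tendsto_const]) auto
  moreover have "(\<lambda>n. (norm (D (x n)))\<^sup>2) \<longlonglongrightarrow> s\<^sup>2"
    by (intro tendsto_intros lim1)
  ultimately have "s\<^sup>2 = 0" by (metis LIMSEQ_unique)
  thus False using s_pos by simp
qed

text \<open>This makes \<open>trace_class\<close> usable: for a state, summability of the diagonal
  of \<open>abs_op\<close> becomes summability of its own diagonal.\<close>

lemma abs_op_positive:
  assumes T: "positive_op T"
  shows "abs_op T = T"
proof -
  have "cadjoint T = T"
    by (rule cadjoint_eqI) (use T in \<open>auto simp: positive_op_iff hermitian_def\<close>)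
  show ?thesis unfolding abs_op_def \<open>cadjoint T = T\<close>
    using T by (auto intro!: the_equality positive_sqrt_unique dest: fun_cong)
qed

text \<open>\<open>R\<close> is the weak sum of the rank-one operators of the \<open>v i\<close>,
  and the summability condition expresses a finite trace. The vectors may be dependent or zero, so
  families produced by elimination qualify.\<close>

definition gram_family :: "('i \<Rightarrow> 'a::complex_hilbert_space) \<Rightarrow> ('a \<Rightarrow> 'a) \<Rightarrow> bool" where
  "gram_family v R \<longleftrightarrow> (\<lambda>i. (norm (v i))\<^sup>2) summable_on UNIV \<and>
     (\<forall>x y. ((\<lambda>i. cinner x (v i) * cinner (v i) y) has_sum cinner x (R y)) UNIV)"

text \<open>A column of the Cholesky factor. If \<open>cinner e (T e)\<close> is 0, division by zero
  makes the pivot 0; for positive \<open>T\<close> this is the right value, because then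
  \<open>T e = 0\<close>.\<close>

definition pivot :: "('a::complex_hilbert_space \<Rightarrow> 'a) \<Rightarrow> 'a \<Rightarrow> 'a" where
  "pivot T e = complex_of_real (1 / sqrt (Re (cinner e (T e)))) *\<^sub>C T e"

definition deflate :: "('a::complex_hilbert_space \<Rightarrow> 'a) \<Rightarrow> 'a \<Rightarrow> 'a \<Rightarrow> 'a" where
  "deflate T e = (\<lambda>x. T x - cinner (pivot T e) x *\<^sub>C pivot T e)"

lemma bounded_clinear_rank_one: "bounded_clinear (\<lambda>x. cinner v x *\<^sub>C v)"
proof -
  have "norm (cinner v x *\<^sub>C v) \<le> norm x * (norm v)\<^sup>2" for x
    using mult_right_mono[OF cinner_Cauchy_Schwarz[of v x], of "norm v"]
    by (simp add: norm_scaleC power2_eq_square mult_ac)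
  thus ?thesis unfolding bounded_clinear_def
    by (auto simp: cinner.add_right scaleC_add_left cinner.scaleC_right scaleC_scaleC)
qed

text \<open>\<open>deflate\<close> is the Schur complement with respect to \<open>e\<close>, and it
  stays positive by Cauchy-Schwarz for the form of \<open>T\<close>. Kernels only grow, so vectors
  eliminated earlier stay eliminated.\<close>

lemma deflate:
  assumes T: "positive_op T"
  shows "positive_op (deflate T e)"
    and "Re (cinner x (deflate T e x)) = Re (cinner x (T x)) - (cmod (cinner (pivot T e) x))\<^sup>2"
    and "deflate T e e = 0"
    and "T x = 0 \<Longrightarrow> deflate T e x = 0"
proof -
  interpret F: positive_form "\<lambda>x y. cinner x (T y)" by (rule positive_op_form[OF T])
  have hT: "\<And>x y. cinner (T x) y = cinner x (T y)" and blT: "bounded_clinear T"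
    using T by (auto simp: positive_op_iff hermitian_def)
  define d where "d = Re (cinner e (T e))"
  have d: "0 \<le> d" unfolding d_def by (rule F.nonneg)
  have q: "Re (cinner x (deflate T e x)) = Re (cinner x (T x)) - (cmod (cinner (pivot T e) x))\<^sup>2" for x
  proof -
    have "cinner (pivot T e) x * cinner x (pivot T e) = of_real ((cmod (cinner (pivot T e) x))\<^sup>2)"
      using complex_norm_square[of "cinner (pivot T e) x"] cinner_commute[of x "pivot T e"] by simp
    thus ?thesis by (simp add: deflate_def cinner.diff_right cinner.scaleC_right)
  qed
  show "Re (cinner x (deflate T e x)) = Re (cinner x (T x)) - (cmod (cinner (pivot T e) x))\<^sup>2"
    by (rule q)
  have le: "(cmod (cinner (pivot T e) x))\<^sup>2 \<le> Re (cinner x (T x))" for x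
  proof (cases "d = 0")
    case True
    thus ?thesis using F.nonneg[of x] by (simp add: pivot_def d_def)
  next
    case False
    hence dp: "0 < d" using d by simp
    have "(cmod (cinner (pivot T e) x))\<^sup>2 = (cmod (cinner e (T x)))\<^sup>2 / d"
      using dp by (simp add: pivot_def d_def[symmetric] cinner.scaleC_left hT norm_mult
          power_mult_distrib norm_divide power_divide)
    also have "\<dots> \<le> (d * Re (cinner x (T x))) / d"
      using F.Cauchy_Schwarz[of e x] dp by (intro divide_right_mono) (simp_all add: d_def)
    finally show ?thesis using dp by simp
  qed
  have bl: "bounded_clinear (deflate T e)"
    unfolding deflate_def by (intro bounded_clinear_diff blT bounded_clinear_rank_one)
  have "cinner (deflate T e x) y = cinner x (deflate T e y)" for x y
    by (simp add: deflate_def cinner.diff_left cinner.diff_right hT cinner.scaleC_left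
        cinner.scaleC_right cinner_commute[symmetric])
  thus "positive_op (deflate T e)"
    unfolding positive_op_iff hermitian_def using bl le q by simp
  show "T x = 0 \<Longrightarrow> deflate T e x = 0"
    by (simp add: deflate_def pivot_def cinner.scaleC_left hT)
  show "deflate T e e = 0"
  proof (cases "d = 0")
    case True
    obtain C where "(norm (T e))\<^sup>2 \<le> C * d" using positive_op_bound[OF T] d_def by metis
    hence "T e = 0" using True by simp
    thus ?thesis by (simp add: deflate_def pivot_def)
  next
    case False
    hence dp: "0 < d" using d by simp
    have "cinner (T e) e = of_real d" using F.self_eq[of e] by (simp add: hT d_def)
    thus ?thesis using dp
      by (simp add: deflate_def pivot_def d_def[symmetric] cinner.scaleC_left scaleC_scaleC
          of_real_mult[symmetric] real_sqrt_mult_self[simplified] del: of_real_mult)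
  qed
qed

primrec cholesky :: "('a::complex_hilbert_space \<Rightarrow> 'a) \<Rightarrow> (nat \<Rightarrow> 'a) \<Rightarrow> nat \<Rightarrow> 'a \<Rightarrow> 'a" where
  "cholesky T e 0 = T"
| "cholesky T e (Suc k) = deflate (cholesky T e k) (e k)"

lemma cholesky:
  assumes T: "positive_op T"
  shows "positive_op (cholesky T e k)"
    and "T x = 0 \<Longrightarrow> cholesky T e k x = 0"
    and "j < k \<Longrightarrow> cholesky T e k (e j) = 0"
    and "Re (cinner x (cholesky T e k x))
      = Re (cinner x (T x)) - (\<Sum>j<k. (cmod (cinner (pivot (cholesky T e j) (e j)) x))\<^sup>2)"
proof -
  show pos: "positive_op (cholesky T e k)" for k
    by (induction k) (simp_all add: T deflate(1))
  show "T x = 0 \<Longrightarrow> cholesky T e k x = 0"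
    by (induction k) (simp_all add: deflate(4)[OF pos])
  show "j < k \<Longrightarrow> cholesky T e k (e j) = 0"
    by (induction k) (auto simp: less_Suc_eq deflate(3,4)[OF pos])
  show "Re (cinner x (cholesky T e k x))
      = Re (cinner x (T x)) - (\<Sum>j<k. (cmod (cinner (pivot (cholesky T e j) (e j)) x))\<^sup>2)"
    by (induction k) (simp_all add: deflate(2)[OF pos])
qed

lemma has_sum_finite_sum:
  fixes f :: "'i \<Rightarrow> 'b \<Rightarrow> 'c::topological_comm_monoid_add"
  assumes "finite J" "\<And>j. j \<in> J \<Longrightarrow> (f j has_sum s j) A"
  shows "((\<lambda>x. \<Sum>j\<in>J. f j x) has_sum (\<Sum>j\<in>J. s j)) A"
  using assms by (induction J rule: finite_induct) (auto intro: has_sum_add)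

lemma gram_family_exists:
  assumes T: "positive_op T" and E: "is_onb E" and tr: "(\<lambda>e. cinner e (T e)) summable_on E"
  shows "\<exists>v :: nat \<Rightarrow> _. gram_family v T"
proof -
  interpret F: positive_form "\<lambda>x y. cinner x (T y)" by (rule positive_op_form[OF T])
  obtain C where C: "0 < C" "\<And>x. Re (cinner x (T x)) \<le> C * (norm x)\<^sup>2"
    "\<And>x. (norm (T x))\<^sup>2 \<le> C * Re (cinner x (T x))"
    using positive_op_bound[OF T] by metis
  \<comment> \<open>The basis may be uncountable, but a summable family has only countably many
    nonzero terms, and a vanishing diagonal entry forces \<open>T e = 0\<close>.\<close>
  define E' where "E' = {e\<in>E. T e \<noteq> 0}"
  have "E' \<subseteq> {e\<in>E. cinner e (T e) \<noteq> 0}"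
  proof
    fix x assume "x \<in> E'"
    thus "x \<in> {e\<in>E. cinner e (T e) \<noteq> 0}" using C(3)[of x] by (auto simp: E'_def)
  qed
  hence cE': "countable (insert 0 E')"
    using summable_countable_complex[OF tr] by (auto intro: countable_subset)
  \<comment> \<open>The inserted 0 makes the set nonempty, so it is the range of a sequence even if
    \<open>E'\<close> is empty. Repeated entries and 0 have zero pivots.\<close>
  define e where "e = from_nat_into (insert 0 E')"
  have re: "range e = insert 0 E'"
    unfolding e_def by (rule range_from_nat_into[OF _ cE']) simp
  define Ch where "Ch = cholesky T e"
  define v where "v k = pivot (Ch k) (e k)" for k
  note ch = cholesky[OF T, where e = e, folded Ch_def, folded v_def]
  have blCh: "bounded_clinear (Ch k)" for k using ch(1) by (simp add: positive_op_def)
  define q where "q k x = Re (cinner x (Ch k x))" for k x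
  have q0: "0 \<le> q k x" for k x
    using ch(1)[of k] by (simp add: q_def positive_op_iff)
  have qle: "q k x \<le> C * (norm x)\<^sup>2" for k x
  proof -
    have "q k x \<le> Re (cinner x (T x))"
      unfolding q_def ch(4) by (simp add: sum_nonneg)
    thus ?thesis using C(2)[of x] by linarith
  qed
  \<comment> \<open>On finite combinations of basis vectors the elimination stops after finitely
    many steps.\<close>
  have qspan: "\<exists>N. \<forall>k\<ge>N. Ch k x = 0" if "x \<in> complex_vector.span E" for x
    using that
  proof (induction rule: complex_vector.span_induct_alt)
    case base
    show ?case by (simp add: bounded_clinear_simps[OF blCh])
  next
    case (step c b y)
    have "\<exists>M. \<forall>k\<ge>M. Ch k b = 0"
    proof (cases "T b = 0")
      case True
      thus ?thesis using ch(2) by blast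
    next
      case False
      hence "b \<in> range e" using step(1) re by (simp add: E'_def)
      then obtain n where "b = e n" by blast
      thus ?thesis using ch(3)[of n] by (auto intro!: exI[of _ "Suc n"])
    qed
    then obtain M N where "\<forall>k\<ge>M. Ch k b = 0" "\<forall>k\<ge>N. Ch k y = 0" using step(2) by blast
    thus ?case by (intro exI[of _ "max M N"]) (simp add: bounded_clinearD[OF blCh])
  qed
  \<comment> \<open>Density carries this over to all \<open>x\<close>: the remainders obey the bound
    \<open>C\<close> uniformly in \<open>k\<close>, and the factor 2 of the parallelogram law
    explains \<open>\<epsilon> / (2 * C)\<close>.\<close>
  have qlim: "(\<lambda>k. q k x) \<longlonglongrightarrow> 0" for x
  proof (rule LIMSEQ_I)
    fix \<epsilon> :: real assume "0 < \<epsilon>"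
    hence "x \<in> closure (complex_vector.span E)" "0 < sqrt (\<epsilon> / (2 * C))"
      using E C(1) by (auto simp: is_onb_def)
    then obtain u where u: "u \<in> complex_vector.span E" "dist u x < sqrt (\<epsilon> / (2 * C))"
      unfolding closure_approachable by blast
    obtain N where N: "\<forall>k\<ge>N. Ch k u = 0" using qspan[OF u(1)] by blast
    have "norm (q k x - 0) < \<epsilon>" if "k \<ge> N" for k
    proof -
      interpret P: positive_form "\<lambda>x y. cinner x (Ch k y)" by (rule positive_op_form[OF ch(1)])
      have "(norm (x - u))\<^sup>2 < (sqrt (\<epsilon> / (2 * C)))\<^sup>2"
        using u(2) by (intro power_strict_mono) (auto simp: dist_norm norm_minus_commute)
      hence "2 * (C * (norm (x - u))\<^sup>2) < \<epsilon>"
        using C(1) \<open>0 < \<epsilon>\<close> by (simp add: field_simps)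
      moreover have "q k x \<le> 2 * q k u + 2 * q k (x - u)"
        using P.parallelogram[of u "x - u"] by (simp add: q_def)
      moreover have "q k u = 0" using N that by (simp add: q_def)
      ultimately show ?thesis using qle[of k "x - u"] q0[of k x] by simp
    qed
    thus "\<exists>N. \<forall>k\<ge>N. norm (q k x - 0) < \<epsilon>" by blast
  qed
  have diag: "((\<lambda>k. (cmod (cinner (v k) x))\<^sup>2) has_sum Re (cinner x (T x))) UNIV" for x
  proof (rule sums_nonneg_imp_has_sum)
    have "(\<lambda>n. Re (cinner x (T x)) - q n x) \<longlonglongrightarrow> Re (cinner x (T x)) - 0"
      by (intro tendsto_intros qlim)
    thus "(\<lambda>k. (cmod (cinner (v k) x))\<^sup>2) sums Re (cinner x (T x))"
      by (simp add: sums_def q_def ch(4))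
  qed simp
  have "((\<lambda>k. cinner x (v k) * cinner (v k) y) has_sum cinner x (T y)) UNIV" for x y
    by (rule F.has_sum_polarization[OF cinner.positive_form_axioms diag])
  \<comment> \<open>Parseval turns a finite sum of squared norms into a sum over \<open>E\<close>,
    where \<open>diag\<close> bounds each term by \<open>cinner e (T e)\<close>.\<close>
  moreover have "(\<lambda>k. (norm (v k))\<^sup>2) summable_on UNIV"
  proof (rule nonneg_bounded_partial_sums_imp_summable_on)
    show "\<forall>\<^sub>F J in finite_subsets_at_top UNIV.
        (\<Sum>k\<in>J. (norm (v k))\<^sup>2) \<le> (\<Sum>\<^sub>\<infinity>e\<in>E. Re (cinner e (T e)))"
    proof (rule eventually_finite_subsets_at_top_weakI)
      fix J :: "nat set" assume "finite J"
      show "(\<Sum>k\<in>J. (norm (v k))\<^sup>2) \<le> (\<Sum>\<^sub>\<infinity>e\<in>E. Re (cinner e (T e)))"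
      proof (rule has_sum_mono)
        show "((\<lambda>e. \<Sum>k\<in>J. (cmod (cinner e (v k)))\<^sup>2) has_sum (\<Sum>k\<in>J. (norm (v k))\<^sup>2)) E"
          by (intro has_sum_finite_sum \<open>finite J\<close> onb_Parseval_diag[OF E])
        show "((\<lambda>e. Re (cinner e (T e))) has_sum (\<Sum>\<^sub>\<infinity>e\<in>E. Re (cinner e (T e)))) E"
          by (intro has_sum_infsum summable_on_Re tr)
        show "(\<Sum>k\<in>J. (cmod (cinner e (v k)))\<^sup>2) \<le> Re (cinner e (T e))" for e
          using finite_sum_le_has_sum[OF diag[of e] \<open>finite J\<close>]
          by (simp add: cinner.cmod_commute[of e])
      qed
    qed
  qed simp
  ultimately show ?thesis unfolding gram_family_def by blast
qed

lemma state_onb: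
  fixes \<rho> :: "'a::complex_hilbert_space \<Rightarrow> 'a"
  assumes "state \<rho>" shows "\<exists>E :: 'a set. is_onb E"
  using assms by (auto simp: state_def trace_class_def)

lemma state_summable:
  assumes "state \<rho>"
  obtains E where "is_onb E" "(\<lambda>e. cinner e (\<rho> e)) summable_on E"
  using assms abs_op_positive[of \<rho>] by (auto simp: state_def trace_class_def)

lemma state_gram_family:
  assumes "state \<rho>" shows "\<exists>v :: nat \<Rightarrow> _. gram_family v \<rho>"
  using assms state_summable gram_family_exists by (metis state_def)

section \<open>Traces\<close>

text \<open>Fubini for \<open>cinner (u i) e * cinner e (w i)\<close>, absolutely summable because
  each modulus is at most half a sum of two squares. It makes traces independent of the basis picked
  by \<open>op_trace\<close>.\<close>

lemma has_sum_onb_families: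
  fixes u w :: "'i \<Rightarrow> 'a::complex_hilbert_space"
  assumes E: "is_onb E"
    and u: "(\<lambda>i. (norm (u i))\<^sup>2) summable_on UNIV" and w: "(\<lambda>i. (norm (w i))\<^sup>2) summable_on UNIV"
  shows "((\<lambda>i. cinner (u i) (w i)) has_sum (\<Sum>\<^sub>\<infinity>i. cinner (u i) (w i))) UNIV"
    and "((\<lambda>e. \<Sum>\<^sub>\<infinity>i. cinner (u i) e * cinner e (w i)) has_sum (\<Sum>\<^sub>\<infinity>i. cinner (u i) (w i))) E"
proof -
  define f where "f = (\<lambda>(i, e). cinner (u i) e * cinner e (w i))"
  have "(\<lambda>(i, e). 1/2 * ((cmod (cinner e (u i)))\<^sup>2 + (cmod (cinner e (w i)))\<^sup>2)) summable_on (UNIV \<times> E)"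
  proof (rule summable_on_SigmaI)
    fix i
    show "((\<lambda>e. case (i, e) of (i, e) \<Rightarrow> 1/2 * ((cmod (cinner e (u i)))\<^sup>2 + (cmod (cinner e (w i)))\<^sup>2))
        has_sum 1/2 * ((norm (u i))\<^sup>2 + (norm (w i))\<^sup>2)) E"
      unfolding prod.case by (intro has_sum_cmult_right has_sum_add onb_Parseval_diag[OF E])
  next
    show "(\<lambda>i. 1/2 * ((norm (u i))\<^sup>2 + (norm (w i))\<^sup>2)) summable_on UNIV"
      by (intro summable_on_cmult_right summable_on_add u w)
  qed auto
  moreover have "norm (f p) \<le> (case p of (i, e) \<Rightarrow> 1/2 * ((cmod (cinner e (u i)))\<^sup>2 + (cmod (cinner e (w i)))\<^sup>2))"
    for p
    using sum_squares_bound[of "cmod (cinner (snd p) (u (fst p)))" "cmod (cinner (snd p) (w (fst p)))"]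
    by (simp add: f_def split_beta norm_mult cinner.cmod_commute[of "u _"])
  ultimately have "(\<lambda>p. norm (f p)) summable_on (UNIV \<times> E)"
    by (rule summable_on_comparison_test) simp
  hence f: "f summable_on (UNIV \<times> E)" by (rule abs_summable_summable)
  then obtain S where S: "(f has_sum S) (UNIV \<times> E)" by (auto simp: summable_on_def)
  have 1: "((\<lambda>i. cinner (u i) (w i)) has_sum S) UNIV"
    by (rule has_sum_SigmaD[OF S]) (simp add: f_def onb_Parseval[OF E])
  hence S_eq: "S = (\<Sum>\<^sub>\<infinity>i. cinner (u i) (w i))" by (simp add: infsumI)
  show "((\<lambda>i. cinner (u i) (w i)) has_sum (\<Sum>\<^sub>\<infinity>i. cinner (u i) (w i))) UNIV"
    using 1 S_eq by simp
  have S': "((\<lambda>(e, i). cinner (u i) e * cinner e (w i)) has_sum S) (E \<times> UNIV)"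
    using S unfolding f_def by (subst has_sum_swap) simp
  have "((\<lambda>e. \<Sum>\<^sub>\<infinity>i. cinner (u i) e * cinner e (w i)) has_sum S) E"
  proof (rule has_sum_SigmaD[OF S'])
    fix e assume "e \<in> E"
    hence "(\<lambda>i. cinner (u i) e * cinner e (w i)) summable_on UNIV"
      using summable_on_SigmaD1[of "\<lambda>e i. cinner (u i) e * cinner e (w i)" E "\<lambda>_. UNIV" e]
        has_sum_imp_summable[OF S'] by simp
    thus "((\<lambda>i. case (e, i) of (e, i) \<Rightarrow> cinner (u i) e * cinner e (w i)) has_sum
        (\<Sum>\<^sub>\<infinity>i. cinner (u i) e * cinner e (w i))) UNIV" by simp
  qed
  thus "((\<lambda>e. \<Sum>\<^sub>\<infinity>i. cinner (u i) e * cinner e (w i)) has_sum (\<Sum>\<^sub>\<infinity>i. cinner (u i) (w i))) E"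
    using S_eq by simp
qed

lemma summable_bounded_image:
  assumes X: "bounded_clinear X" and v: "(\<lambda>i. (norm (v i))\<^sup>2) summable_on A"
  shows "(\<lambda>i. (norm (X (v i)))\<^sup>2) summable_on A"
proof -
  obtain K where K: "0 < K" "\<And>x. norm (X x) \<le> K * norm x" using bounded_clinear_bound[OF X] by metis
  show ?thesis
  proof (rule summable_on_comparison_test)
    show "(\<lambda>i. K\<^sup>2 * (norm (v i))\<^sup>2) summable_on A" by (intro summable_on_cmult_right v)
    show "(norm (X (v i)))\<^sup>2 \<le> K\<^sup>2 * (norm (v i))\<^sup>2" for i
      using power_mono[OF K(2)[of "v i"], of 2] by (simp add: power_mult_distrib)
  qed simp
qed

lemma gram_family_has_sum:
  assumes onb: "\<exists>E :: 'a::complex_hilbert_space set. is_onb E"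
    and R: "gram_family v (R :: 'a \<Rightarrow> 'a)"
    and X: "bounded_clinear (X :: 'a \<Rightarrow> 'a)" and Y: "bounded_clinear (Y :: 'a \<Rightarrow> 'a)"
  shows "((\<lambda>i. cinner (X (v i)) (Y (v i))) has_sum (\<Sum>\<^sub>\<infinity>i. cinner (X (v i)) (Y (v i)))) UNIV"
proof -
  obtain E :: "'a set" where E: "is_onb E" using onb by blast
  have v: "(\<lambda>i. (norm (v i))\<^sup>2) summable_on UNIV" using R by (simp add: gram_family_def)
  show ?thesis
    by (rule has_sum_onb_families(1)[OF E summable_bounded_image[OF X v] summable_bounded_image[OF Y v]])
qed

text \<open>\<open>Y\<close> is the adjoint of \<open>X\<close> and moves it to the side where the
  expansion of \<open>R\<close> applies. Both orders of the product occur, in \<open>expect\<close>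
  and in \<open>meas_error\<close>.\<close>

lemma op_trace_gram_family:
  assumes onb: "\<exists>E :: 'a::complex_hilbert_space set. is_onb E"
    and R: "gram_family v (R :: 'a \<Rightarrow> 'a)" and X: "bounded_clinear X" and Y: "bounded_clinear Y"
    and adj: "\<And>x y. cinner (Y x) y = cinner x (X y)"
  shows "op_trace (X \<circ> R) = (\<Sum>\<^sub>\<infinity>i. cinner (v i) (X (v i)))"
    and "op_trace (R \<circ> X) = (\<Sum>\<^sub>\<infinity>i. cinner (v i) (X (v i)))"
proof -
  define E :: "'a set" where "E = (SOME E. is_onb E)"
  have E: "is_onb E" unfolding E_def using onb by (rule someI_ex)
  have v: "(\<lambda>i. (norm (v i))\<^sup>2) summable_on UNIV"
    and R': "((\<lambda>i. cinner x (v i) * cinner (v i) y) has_sum cinner x (R y)) UNIV" for x y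
    using R by (auto simp: gram_family_def)
  have "cinner e (X (R e)) = (\<Sum>\<^sub>\<infinity>i. cinner (v i) e * cinner e (X (v i)))" for e
    using infsumI[OF R'[of "Y e" e]] by (simp add: adj mult.commute)
  thus "op_trace (X \<circ> R) = (\<Sum>\<^sub>\<infinity>i. cinner (v i) (X (v i)))"
    unfolding op_trace_def E_def[symmetric]
    using infsumI[OF has_sum_onb_families(2)[OF E v summable_bounded_image[OF X v]]] by simp
  have "cinner e (R (X e)) = (\<Sum>\<^sub>\<infinity>i. cinner (Y (v i)) e * cinner e (v i))" for e
    using infsumI[OF R'[of e "X e"]] by (simp add: adj mult.commute)
  thus "op_trace (R \<circ> X) = (\<Sum>\<^sub>\<infinity>i. cinner (v i) (X (v i)))"
    unfolding op_trace_def E_def[symmetric]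
    using infsumI[OF has_sum_onb_families(2)[OF E summable_bounded_image[OF Y v] v]]
    by (simp add: adj)
qed

section \<open>Tensor products\<close>

text \<open>The induction removes one summand by making the remaining \<open>y i\<close>
  orthogonal to it with respect to \<open>G\<close>.\<close>

lemma Schur_product_nonneg:
  assumes F: "positive_form F" and G: "positive_form G" and "finite I"
  shows "0 \<le> Re (\<Sum>i\<in>I. \<Sum>j\<in>I. F (x i) (x j) * G (y i) (y j))"
  using \<open>finite I\<close>
proof (induction I arbitrary: x y rule: finite_induct)
  case (insert n I)
  interpret F: positive_form F by fact
  interpret G: positive_form G by fact
  define d where "d = G (y n) (y n)"
  have d: "cnj d = d" "0 \<le> Re d" "Im d = 0"
    using G.commute[of "y n" "y n"] G.nonneg[of "y n"] by (simp_all add: d_def)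
  define c where "c i = G (y n) (y i) / d" for i
  \<comment> \<open>If \<open>d = 0\<close>, then \<open>y n\<close> is a null vector of
    \<open>G\<close> and both sides vanish, so the division by zero in \<open>c\<close> does no
    harm.\<close>
  have cd: "G (y n) (y i) = d * c i" for i
  proof (cases "d = 0")
    case True
    hence "G (y i) (y n) = 0" by (intro G.null_right) (simp add: d_def)
    thus ?thesis using True G.commute[of "y n" "y i"] by simp
  qed (simp add: c_def)
  have cd': "G (y i) (y n) = d * cnj (c i)" for i
    using cd[of i] G.commute[of "y i" "y n"] d by simp
  define y' where "y' i = y i - c i *\<^sub>C y n" for i
  \<comment> \<open>Completing the square: all terms that involve \<open>n\<close> or the
    coefficients \<open>c i\<close> add up to \<open>d * F x' x'\<close>.\<close>
  define x' where "x' = x n + (\<Sum>i\<in>I. c i *\<^sub>C x i)"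
  have GG: "G (y i) (y j) = G (y' i) (y' j) + cnj (c i) * c j * d" for i j
    by (simp add: y'_def G.diff_left G.diff_right G.scaleC_left G.scaleC_right
        d_def[symmetric]) (simp add: cd cd')
  have 1: "F x' x' = F (x n) (x n) + (\<Sum>i\<in>I. c i * F (x n) (x i))
      + (\<Sum>i\<in>I. cnj (c i) * F (x i) (x n)) + (\<Sum>i\<in>I. \<Sum>j\<in>I. cnj (c i) * (c j * F (x i) (x j)))"
  proof -
    have l: "F x' z = F (x n) z + (\<Sum>i\<in>I. cnj (c i) * F (x i) z)" for z
      by (simp add: x'_def F.add_left F.sum_left F.scaleC_left)
    have r: "F z x' = F z (x n) + (\<Sum>i\<in>I. c i * F z (x i))" for z
      by (simp add: x'_def F.add_right F.sum_right F.scaleC_right)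
    show ?thesis unfolding l unfolding r
      by (simp add: sum.distrib sum_distrib_left distrib_left)
  qed
  have "(\<Sum>i\<in>insert n I. \<Sum>j\<in>insert n I. F (x i) (x j) * G (y i) (y j))
      = F (x n) (x n) * d + (\<Sum>i\<in>I. F (x n) (x i) * G (y n) (y i))
        + (\<Sum>i\<in>I. F (x i) (x n) * G (y i) (y n))
        + (\<Sum>i\<in>I. \<Sum>j\<in>I. F (x i) (x j) * G (y i) (y j))"
    using insert by (simp add: sum.distrib d_def)
  also have "(\<Sum>i\<in>I. \<Sum>j\<in>I. F (x i) (x j) * G (y i) (y j))
      = (\<Sum>i\<in>I. \<Sum>j\<in>I. F (x i) (x j) * G (y' i) (y' j))
        + d * (\<Sum>i\<in>I. \<Sum>j\<in>I. cnj (c i) * (c j * F (x i) (x j)))"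
    by (simp add: GG sum.distrib sum_distrib_left algebra_simps)
  also have "F (x n) (x n) * d + (\<Sum>i\<in>I. F (x n) (x i) * G (y n) (y i))
        + (\<Sum>i\<in>I. F (x i) (x n) * G (y i) (y n)) + \<dots>
      = (\<Sum>i\<in>I. \<Sum>j\<in>I. F (x i) (x j) * G (y' i) (y' j)) + d * F x' x'"
    unfolding 1 cd cd' by (simp add: sum_distrib_left algebra_simps)
  finally show ?case
    using insert.IH[of x y'] F.nonneg[of x'] d by simp
qed simp

lemma dense_bounded_extension:
  fixes f :: "'a::complex_hilbert_space \<Rightarrow> 'b::complex_hilbert_space"
  assumes dense: "closure (complex_vector.span S) = UNIV"
    and add: "\<And>x y. x \<in> complex_vector.span S \<Longrightarrow> y \<in> complex_vector.span S \<Longrightarrow> f (x + y) = f x + f y"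
    and scale: "\<And>c x. x \<in> complex_vector.span S \<Longrightarrow> f (c *\<^sub>C x) = c *\<^sub>C f x"
    and bound: "\<And>x. x \<in> complex_vector.span S \<Longrightarrow> norm (f x) \<le> K * norm x"
  obtains W where "bounded_clinear W" "\<And>x. x \<in> complex_vector.span S \<Longrightarrow> W x = f x"
proof -
  let ?S = "complex_vector.span S"
  have diff: "f (x - y) = f x - f y" if "x \<in> ?S" "y \<in> ?S" for x y
    using add[of "x - y" y] that by (simp add: complex_vector.span_diff)
  \<comment> \<open>On the zero space \<open>K\<close> may be negative, while a Lipschitz constant
    must not be.\<close>
  have "(max K 0)-lipschitz_on ?S f"
  proof (rule lipschitz_onI)
    fix x y assume xy: "x \<in> ?S" "y \<in> ?S"
    have "norm (f x - f y) \<le> K * norm (x - y)"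
      using bound[of "x - y"] xy diff by (simp add: complex_vector.span_diff)
    also have "\<dots> \<le> max K 0 * norm (x - y)" by (intro mult_right_mono) auto
    finally show "dist (f x) (f y) \<le> max K 0 * dist x y" by (simp add: dist_norm)
  qed simp
  hence "uniformly_continuous_on ?S f" by (rule lipschitz_on_uniformly_continuous)
  then obtain W where "uniformly_continuous_on (closure ?S) W" and Wf: "\<And>x. x \<in> ?S \<Longrightarrow> f x = W x"
    using uniformly_continuous_on_extension_on_closure by metis
  hence cont: "continuous_on UNIV W"
    using dense uniformly_continuous_imp_continuous by metis
  have closedI: "P z" if "closed {z. P z}" "\<And>z. z \<in> ?S \<Longrightarrow> P z" for P :: "'a \<Rightarrow> bool" and z
    using closure_minimal[of ?S "{z. P z}"] that dense by auto
  have shift: "continuous_on UNIV (\<lambda>z. W (g z))" if "continuous_on UNIV g" for g :: "'a \<Rightarrow> 'a"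
    by (rule continuous_on_compose2[OF cont that]) simp
  \<comment> \<open>Additivity passes to the limit in one variable at a time, first in
    \<open>y\<close> with \<open>x\<close> still in the span.\<close>
  have "W (x + y) = W x + W y" if x: "x \<in> ?S" for x y
    by (rule closedI[of "\<lambda>y. W (x + y) = W x + W y"])
      (use x in \<open>auto intro!: closed_Collect_eq continuous_intros shift
        simp: Wf[symmetric] add complex_vector.span_add\<close>)
  hence "W (x + y) = W x + W y" for x y
    by (rule_tac closedI[of "\<lambda>x. W (x + y) = W x + W y"])
      (auto intro!: closed_Collect_eq continuous_intros shift)
  moreover have "W (c *\<^sub>C x) = c *\<^sub>C W x" for c x
    by (rule closedI[of "\<lambda>x. W (c *\<^sub>C x) = c *\<^sub>C W x"])
      (auto intro!: closed_Collect_eq shift bounded_clinear_continuous_on[OF bounded_clinear_scaleC]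
        continuous_on_compose2[OF bounded_clinear_continuous_on[OF bounded_clinear_scaleC] cont]
        simp: Wf[symmetric] scale complex_vector.span_scale)
  moreover have "norm (W x) \<le> K * norm x" for x
    by (rule closedI[of "\<lambda>x. norm (W x) \<le> K * norm x"])
      (auto intro!: closed_Collect_le continuous_intros cont simp: Wf[symmetric] bound)
  ultimately have "bounded_clinear W"
    unfolding bounded_clinear_def by (auto simp: mult.commute)
  thus ?thesis using that Wf by simp
qed

lemma closure_span_step:
  assumes "u \<in> closure (complex_vector.span P)" "v \<in> closure (complex_vector.span P)"
  shows "c *\<^sub>C u + v \<in> closure (complex_vector.span P)"
proof -
  obtain p q where pq: "\<And>n. p n \<in> complex_vector.span P" "p \<longlonglongrightarrow> u"
      "\<And>n. q n \<in> complex_vector.span P" "q \<longlonglongrightarrow> v"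
    using assms unfolding closure_sequential by blast
  have "(\<lambda>n. c *\<^sub>C p n + q n) \<longlonglongrightarrow> c *\<^sub>C u + v"
    by (intro tendsto_add pq
        bounded_linear.tendsto[OF bounded_clinear_imp_bounded_linear[OF bounded_clinear_scaleC]])
  thus ?thesis unfolding closure_sequential
    using pq by (intro exI[of _ "\<lambda>n. c *\<^sub>C p n + q n"])
      (simp add: complex_vector.span_add complex_vector.span_scale)
qed

text \<open>A converse of \<open>gram_family_exists\<close>. Applied to the products of two families
  it supplies the operator that turns out to be \<open>\<rho> \<otimes> \<sigma>\<close>.\<close>

lemma gram_operator:
  assumes g: "(\<lambda>i. (norm (g i))\<^sup>2) summable_on UNIV"
  obtains W where "bounded_clinear W" "gram_family g W"
proof -
  define W where "W z = (\<Sum>\<^sub>\<infinity>i. cinner (g i) z *\<^sub>C g i)" for z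
  have le: "norm (cinner (g i) z *\<^sub>C g i) \<le> (norm (g i))\<^sup>2 * norm z" for i z
    using mult_right_mono[OF cinner_Cauchy_Schwarz[of "g i" z], of "norm (g i)"]
    by (simp add: norm_scaleC power2_eq_square mult_ac)
  have gz: "(\<lambda>i. (norm (g i))\<^sup>2 * norm z) summable_on UNIV" for z
    by (intro summable_on_cmult_left g)
  have abs: "(\<lambda>i. norm (cinner (g i) z *\<^sub>C g i)) summable_on UNIV" for z
    by (rule summable_on_comparison_test[OF gz[of z]]) (simp_all add: le)
  have W: "((\<lambda>i. cinner (g i) z *\<^sub>C g i) has_sum W z) UNIV" for z
    unfolding W_def by (rule has_sum_infsum[OF abs_summable_summable[OF abs]])
  have "W (x + y) = W x + W y" for x y
    using has_sum_add[OF W[of x] W[of y]]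
    by (rule_tac has_sum_unique[OF W]) (simp add: cinner.add_right scaleC_add_left)
  moreover have "W (c *\<^sub>C x) = c *\<^sub>C W x" for c x
    using has_sum_bounded_linear[OF bounded_clinear_imp_bounded_linear[OF bounded_clinear_scaleC] W[of x]]
    by (rule_tac has_sum_unique[OF W]) (simp add: cinner.scaleC_right scaleC_scaleC)
  moreover have "norm (W z) \<le> norm z * (\<Sum>\<^sub>\<infinity>i. (norm (g i))\<^sup>2)" for z
  proof -
    have "norm (W z) \<le> (\<Sum>\<^sub>\<infinity>i. norm (cinner (g i) z *\<^sub>C g i))"
      unfolding W_def by (rule norm_infsum_bound[OF abs])
    also have "\<dots> \<le> (\<Sum>\<^sub>\<infinity>i. (norm (g i))\<^sup>2 * norm z)"
      by (rule infsum_mono, rule abs, rule gz, rule le)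
    also have "\<dots> = (\<Sum>\<^sub>\<infinity>i. (norm (g i))\<^sup>2) * norm z"
      by (rule infsum_cmult_left[OF g])
    finally show ?thesis by (simp add: mult.commute)
  qed
  ultimately have "bounded_clinear W" unfolding bounded_clinear_def by blast
  moreover have "((\<lambda>i. cinner x (g i) * cinner (g i) y) has_sum cinner x (W y)) UNIV" for x y
    using has_sum_bounded_linear[OF bounded_linear_cinner_right W[of y], of x]
    by (simp add: cinner.scaleC_right mult.commute)
  ultimately show ?thesis using that g unfolding gram_family_def by blast
qed

locale hilbert_tensor =
  fixes t :: "'h::complex_hilbert_space \<Rightarrow> 'k::complex_hilbert_space \<Rightarrow> 'hk::complex_hilbert_space"
  assumes tensor: "hilbert_tensor_product t"
begin

lemma add_left: "t (x + x') y = t x y + t x' y"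
  and add_right: "t x (y + y') = t x y + t x y'"
  and scaleC_left: "t (c *\<^sub>C x) y = c *\<^sub>C t x y"
  and scaleC_right: "t x (c *\<^sub>C y) = c *\<^sub>C t x y"
  and inner: "cinner (t x y) (t x' y') = cinner x x' * cinner y y'"
  and dense: "closure (complex_vector.span {t x y |x y. True}) = UNIV"
  using tensor by (auto simp: hilbert_tensor_product_def)

lemma flip: "hilbert_tensor (\<lambda>y x. t x y)"
proof
  have "{(\<lambda>y x. t x y) y x |y x. True} = {t x y |x y. True}" by blast
  hence "closure (complex_vector.span {(\<lambda>y x. t x y) y x |y x. True}) = UNIV"
    using dense by (simp only:)
  thus "hilbert_tensor_product (\<lambda>y x. t x y)"
    unfolding hilbert_tensor_product_def
    by (simp add: add_left add_right scaleC_left scaleC_right inner mult.commute)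
qed

lemma norm_tensor: "norm (t x y) = norm x * norm y"
proof -
  have "(norm (t x y))\<^sup>2 = (norm x * norm y)\<^sup>2"
    unfolding Re_cinner_self[symmetric] inner by (simp add: cinner_norm power_mult_distrib)
  thus ?thesis by (simp add: power2_eq_iff_nonneg)
qed

lemma bounded_clinear_left: "bounded_clinear (\<lambda>x. t x y)"
  unfolding bounded_clinear_def by (auto simp: add_left scaleC_left norm_tensor)

lemma bounded_clinear_right: "bounded_clinear (t x)"
  unfolding bounded_clinear_def by (auto simp: add_right scaleC_right norm_tensor mult.commute)

lemma span_tensor_sum:
  assumes "z \<in> complex_vector.span {t x y |x y. True}"
  obtains n :: nat and x y where "z = (\<Sum>i<n. t (x i) (y i))"
proof -
  have "\<exists>(n :: nat) x y. z = (\<Sum>i<n. t (x i) (y i))"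
    using assms
  proof (induction rule: complex_vector.span_induct_alt)
    case base
    show ?case by (rule exI[of _ 0]) simp
  next
    case (step c b z)
    then obtain u v x y and n :: nat where *: "b = t u v" "z = (\<Sum>i<n. t (x i) (y i))" by blast
    show ?case
      by (intro exI[of _ "Suc n"] exI[of _ "x(n := c *\<^sub>C u)"] exI[of _ "y(n := v)"])
        (simp add: * scaleC_left add.commute)
  qed
  thus ?thesis using that by blast
qed

lemma inner_sum:
  "cinner (\<Sum>i\<in>I. t (x i) (y i)) (\<Sum>j\<in>J. t (x' j) (y' j))
    = (\<Sum>i\<in>I. \<Sum>j\<in>J. cinner (x i) (x' j) * cinner (y i) (y' j))"
  by (simp only: cinner.sum_left) (simp add: cinner.sum_right inner)

lemma tensor_op_eqI:
  assumes "bounded_clinear W" "\<And>x y. W (t x y) = t (S x) (T y)"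
  shows "tensor_op t S T = W"
  unfolding tensor_op_def
proof (rule the_equality)
  show "bounded_clinear W \<and> (\<forall>x y. W (t x y) = t (S x) (T y))" using assms by blast
next
  fix V assume "bounded_clinear V \<and> (\<forall>x y. V (t x y) = t (S x) (T y))"
  thus "V = W" by (intro dense_span_ext[OF dense]) (auto simp: assms)
qed

text \<open>The form \<open>K\<^sup>2 * cinner x x' - cinner (A x) (A x')\<close> is positive, and
  its Schur product with the Gram matrix of the \<open>y i\<close> sums to the difference of the two
  squared norms.\<close>

lemma norm_left_sum_le:
  assumes A: "bounded_clinear A" and K: "\<And>x. norm (A x) \<le> K * norm x" and "finite I"
  shows "norm (\<Sum>i\<in>I. t (A (x i)) (y i)) \<le> K * norm (\<Sum>i\<in>I. t (x i) (y i))"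
proof -
  \<comment> \<open>A nonzero vector is what forces \<open>K\<close> to be nonnegative; without one,
    all tensors vanish.\<close>
  have K0: "0 \<le> K" if "z \<noteq> 0" for z :: 'h
    using order_trans[OF norm_ge_zero K[of z]] that by (simp add: zero_le_mult_iff)
  show ?thesis
  proof (cases "\<exists>z :: 'h. z \<noteq> 0")
    case False
    hence "t (A (x i)) (y i) = 0" for i
      using norm_tensor[of "A (x i)" "y i"] by (metis mult_eq_0_iff norm_eq_zero)
    moreover have "t (x i) (y i) = 0" for i
      using False norm_tensor[of "x i" "y i"] by (metis mult_eq_0_iff norm_eq_zero)
    ultimately show ?thesis by simp
  next
    case True
    interpret F: positive_form "\<lambda>x x'. of_real (K\<^sup>2) * cinner x x' - cinner (A x) (A x')"
    proof
      fix x
      have "(norm (A x))\<^sup>2 \<le> K\<^sup>2 * (norm x)\<^sup>2"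
        using power_mono[OF K[of x], of 2] by (simp add: power_mult_distrib)
      thus "0 \<le> Re (of_real (K\<^sup>2) * cinner x x - cinner (A x) (A x))"
        by (simp add: cinner_norm)
    qed (simp_all add: bounded_clinearD[OF A] cinner.add_right cinner.scaleC_right algebra_simps
        cinner_commute[symmetric])
    have "0 \<le> Re (\<Sum>i\<in>I. \<Sum>j\<in>I. (of_real (K\<^sup>2) * cinner (x i) (x j) - cinner (A (x i)) (A (x j)))
        * cinner (y i) (y j))"
      by (rule Schur_product_nonneg[OF F.positive_form_axioms cinner.positive_form_axioms \<open>finite I\<close>])
    also have "(\<Sum>i\<in>I. \<Sum>j\<in>I. (of_real (K\<^sup>2) * cinner (x i) (x j) - cinner (A (x i)) (A (x j)))
        * cinner (y i) (y j))
      = of_real (K\<^sup>2) * cinner (\<Sum>i\<in>I. t (x i) (y i)) (\<Sum>i\<in>I. t (x i) (y i))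
        - cinner (\<Sum>i\<in>I. t (A (x i)) (y i)) (\<Sum>i\<in>I. t (A (x i)) (y i))"
      unfolding inner_sum by (simp add: sum_distrib_left sum_subtractf algebra_simps)
    finally have "(norm (\<Sum>i\<in>I. t (A (x i)) (y i)))\<^sup>2 \<le> (K * norm (\<Sum>i\<in>I. t (x i) (y i)))\<^sup>2"
      by (simp add: cinner_norm power_mult_distrib)
    thus ?thesis using True K0 by (auto intro: power2_le_imp_le)
  qed
qed

lemma tensor_op_left:
  assumes A: "bounded_clinear A"
  shows "bounded_clinear (tensor_op t A id)" and "tensor_op t A id (t x y) = t (A x) y"
proof -
  let ?S = "complex_vector.span {t x y |x y. True}"
  obtain K where K: "\<And>x. norm (A x) \<le> K * norm x" using bounded_clinear_bound[OF A] by metis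
  \<comment> \<open>A list of pairs represents a finite sum of elementary tensors:
    \<open>\<phi>\<close> evaluates it, \<open>\<psi>\<close> evaluates it after applying
    \<open>A\<close> to the left factors.\<close>
  define \<phi> where "\<phi> xs = (\<Sum>(x, y)\<leftarrow>xs. t x y)" for xs
  define \<psi> where "\<psi> xs = (\<Sum>(x, y)\<leftarrow>xs. t (A x) y)" for xs
  have app: "\<phi> (xs @ ys) = \<phi> xs + \<phi> ys" "\<psi> (xs @ ys) = \<psi> xs + \<psi> ys" for xs ys
    by (simp_all add: \<phi>_def \<psi>_def)
  define sc where "sc c = map (\<lambda>(x :: 'h, y :: 'k). (c *\<^sub>C x, y))" for c
  have sc: "\<phi> (sc c xs) = c *\<^sub>C \<phi> xs" "\<psi> (sc c xs) = c *\<^sub>C \<psi> xs" for c xs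
    by (induction xs)
      (auto simp: \<phi>_def \<psi>_def sc_def scaleC_left bounded_clinearD[OF A] scaleC_add_right)
  have bound: "norm (\<psi> xs) \<le> K * norm (\<phi> xs)" for xs
    using norm_left_sum_le[OF A K, of "{0..<length xs}" "\<lambda>i. fst (xs ! i)" "\<lambda>i. snd (xs ! i)"]
    by (simp add: \<phi>_def \<psi>_def sum_list_sum_nth split_beta)
  \<comment> \<open>The list \<open>xs @ sc (-1) ys\<close> represents 0, and the norm bound sends
    it to 0. Hence the image depends on the vector and not on its representation.\<close>
  have eq: "\<psi> xs = \<psi> ys" if "\<phi> xs = \<phi> ys" for xs ys
    using bound[of "xs @ sc (-1) ys"] that by (simp add: app sc)
  have ex: "\<exists>xs. z = \<phi> xs" if "z \<in> ?S" for z
    using that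
  proof (induction rule: complex_vector.span_induct_alt)
    case base
    show ?case by (rule exI[of _ "[]"]) (simp add: \<phi>_def)
  next
    case (step c b z)
    then obtain u v xs where "b = t u v" "z = \<phi> xs" by blast
    thus ?case by (intro exI[of _ "(c *\<^sub>C u, v) # xs"]) (simp add: \<phi>_def scaleC_left)
  qed
  define f where "f z = \<psi> (SOME xs. z = \<phi> xs)" for z
  have f: "f (\<phi> xs) = \<psi> xs" for xs
    unfolding f_def by (rule eq) (metis (mono_tags) someI)
  obtain W where W: "bounded_clinear W" "\<And>z. z \<in> ?S \<Longrightarrow> W z = f z"
  proof (rule dense_bounded_extension[OF dense, of f K])
    fix x y assume "x \<in> ?S" "y \<in> ?S"
    thus "f (x + y) = f x + f y" using ex by (metis app f)
  next
    fix c x assume "x \<in> ?S"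
    thus "f (c *\<^sub>C x) = c *\<^sub>C f x" using ex by (metis sc f)
  next
    fix x assume "x \<in> ?S"
    thus "norm (f x) \<le> K * norm x" using ex bound by (metis f)
  qed blast
  have Wt: "W (t x y) = t (A x) (id y)" for x y
  proof -
    have "W (t x y) = f (t x y)" by (rule W(2)) (auto intro: complex_vector.span_base)
    also have "\<dots> = t (A x) (id y)" using f[of "[(x, y)]"] by (simp add: \<phi>_def \<psi>_def)
    finally show ?thesis .
  qed
  have "tensor_op t A id = W" by (rule tensor_op_eqI[OF W(1) Wt])
  thus "bounded_clinear (tensor_op t A id)" "tensor_op t A id (t x y) = t (A x) y"
    using W(1) Wt by simp_all
qed

lemma tensor_op_right:
  assumes C: "bounded_clinear C"
  shows "bounded_clinear (tensor_op t id C)" and "tensor_op t id C (t x y) = t x (C y)"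
proof -
  interpret f: hilbert_tensor "\<lambda>y x. t x y" by (rule flip)
  have "tensor_op t id C = tensor_op (\<lambda>y x. t x y) C id"
    by (rule tensor_op_eqI) (simp_all add: f.tensor_op_left[OF C])
  thus "bounded_clinear (tensor_op t id C)" "tensor_op t id C (t x y) = t x (C y)"
    by (simp_all add: f.tensor_op_left[OF C])
qed

lemma hermitianI:
  assumes W: "bounded_clinear W"
    and "\<And>x y x' y'. cinner (W (t x y)) (t x' y') = cinner (t x y) (W (t x' y'))"
  shows "hermitian W"
proof -
  have *: "cinner (W (t x y)) z = cinner (t x y) (W z)" for x y z
    using dense
    by (induction z rule: dense_span_induct)
      (auto simp: assms(2) bounded_clinearD[OF W] bounded_clinear_simps[OF W] cinner.add_right
        cinner.scaleC_right intro!: closed_Collect_eq continuous_intros bounded_clinear_continuous_on W)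
  have "cinner (W z') z = cinner z' (W z)" for z z'
    using dense
    by (induction z' rule: dense_span_induct)
      (auto simp: * bounded_clinearD[OF W] bounded_clinear_simps[OF W] cinner.add_left
        cinner.scaleC_left intro!: closed_Collect_eq continuous_intros bounded_clinear_continuous_on W)
  thus ?thesis using W by (simp add: hermitian_def)
qed

lemma hermitian_left: "hermitian A \<Longrightarrow> hermitian (tensor_op t A id)"
  by (rule hermitianI) (auto simp: hermitian_def tensor_op_left inner)

lemma hermitian_right: "hermitian C \<Longrightarrow> hermitian (tensor_op t id C)"
  by (rule hermitianI) (auto simp: hermitian_def tensor_op_right inner)

lemma commute_left_right:
  assumes A: "bounded_clinear A" and C: "bounded_clinear C"
  shows "tensor_op t A id (tensor_op t id C z) = tensor_op t id C (tensor_op t A id z)"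
proof -
  note tl = tensor_op_left[OF A] and tr = tensor_op_right[OF C]
  have "(\<lambda>z. tensor_op t A id (tensor_op t id C z)) = (\<lambda>z. tensor_op t id C (tensor_op t A id z))"
    by (rule dense_span_ext[OF dense bounded_clinear_compose[OF tl(1) tr(1)]
          bounded_clinear_compose[OF tr(1) tl(1)]]) (auto simp: tl(2) tr(2))
  thus ?thesis by (rule fun_cong)
qed

lemma is_onb_tensor:
  assumes E: "is_onb E" and F: "is_onb F"
  shows "is_onb {t e f |e f. e \<in> E \<and> f \<in> F}"
proof -
  let ?P = "{t e f |e f. e \<in> E \<and> f \<in> F}"
  let ?M = "closure (complex_vector.span ?P)"
  have 0: "0 \<in> ?M" using closure_subset complex_vector.span_zero by blast
  \<comment> \<open>Density in two stages: an arbitrary \<open>x\<close> against a basis vector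
    \<open>f\<close>, then an arbitrary \<open>y\<close>.\<close>
  have 1: "t x f \<in> ?M" if "f \<in> F" for x f
    using E[unfolded is_onb_def, THEN conjunct2, THEN conjunct2]
  proof (induction x rule: dense_span_induct)
    case closed
    show ?case
      using closed_vimage[OF closed_closure bounded_clinear_continuous_on[OF bounded_clinear_left]]
      by (simp add: vimage_def)
  next
    case base
    show ?case using 0 by (simp add: bounded_clinear_simps(1)[OF bounded_clinear_left])
  next
    case (step c e x)
    have "t e f \<in> ?M"
      using that step(1) by (intro subsetD[OF closure_subset] complex_vector.span_base) blast
    thus ?case using step(2) by (simp add: add_left scaleC_left closure_span_step)
  qed
  have 2: "t x y \<in> ?M" for x y
    using F[unfolded is_onb_def, THEN conjunct2, THEN conjunct2]
  proof (induction y rule: dense_span_induct)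
    case closed
    show ?case
      using closed_vimage[OF closed_closure bounded_clinear_continuous_on[OF bounded_clinear_right]]
      by (simp add: vimage_def)
  next
    case base
    show ?case using 0 by (simp add: bounded_clinear_simps(1)[OF bounded_clinear_right])
  next
    case (step c f y)
    thus ?case using 1 by (simp add: add_right scaleC_right closure_span_step)
  qed
  have "z \<in> ?M" for z
    using dense
    by (induction z rule: dense_span_induct) (auto simp: 0 2 intro: closure_span_step)
  moreover have "cinner a b = 0" if ab': "a \<in> ?P" "b \<in> ?P" "a \<noteq> b" for a b
  proof -
    obtain e f e' f' where ab: "a = t e f" "b = t e' f'" "e \<in> E" "e' \<in> E" "f \<in> F" "f' \<in> F"
      using ab'(1,2) by blast
    hence "cinner e e' = 0 \<or> cinner f f' = 0" using E F ab'(3) unfolding is_onb_def by metis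
    thus ?thesis by (auto simp: ab inner)
  qed
  ultimately show ?thesis
    using E F unfolding is_onb_def by (auto simp: norm_tensor)
qed

text \<open>The double sum for \<open>cinner (t x' y') (W (t x y))\<close> factors into the
  expansions of \<open>\<rho>\<close> and \<open>\<sigma>\<close>, which identifies \<open>W\<close>
  on elementary tensors.\<close>

lemma gram_family_tensor:
  fixes v :: "'i \<Rightarrow> 'h" and w :: "'j \<Rightarrow> 'k"
  assumes v: "gram_family v \<rho>" and w: "gram_family w \<sigma>"
  shows "gram_family (\<lambda>(k, l). t (v k) (w l)) (tensor_op t \<rho> \<sigma>)"
    and "bounded_clinear (tensor_op t \<rho> \<sigma>)"
    and "tensor_op t \<rho> \<sigma> (t x y) = t (\<rho> x) (\<sigma> y)"
proof -
  let ?g = "\<lambda>(k, l). t (v k) (w l)"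
  have sv: "(\<lambda>k. (norm (v k))\<^sup>2) summable_on UNIV" and sw: "(\<lambda>l. (norm (w l))\<^sup>2) summable_on UNIV"
    and hv: "\<And>x y. ((\<lambda>k. cinner x (v k) * cinner (v k) y) has_sum cinner x (\<rho> y)) UNIV"
    and hw: "\<And>x y. ((\<lambda>l. cinner x (w l) * cinner (w l) y) has_sum cinner x (\<sigma> y)) UNIV"
    using v w by (auto simp: gram_family_def)
  have "(\<lambda>p. (norm (?g p))\<^sup>2) summable_on UNIV \<times> UNIV"
  proof (rule summable_on_SigmaI)
    show "((\<lambda>l. (norm (?g (k, l)))\<^sup>2) has_sum (norm (v k))\<^sup>2 * (\<Sum>\<^sub>\<infinity>l. (norm (w l))\<^sup>2)) UNIV" for k
      unfolding prod.case norm_tensor power_mult_distrib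
      by (intro has_sum_cmult_right has_sum_infsum sw)
    show "(\<lambda>k. (norm (v k))\<^sup>2 * (\<Sum>\<^sub>\<infinity>l. (norm (w l))\<^sup>2)) summable_on UNIV"
      by (intro summable_on_cmult_left sv)
  qed simp
  then obtain W where W: "bounded_clinear W" "gram_family ?g W"
    using gram_operator[of ?g] by (auto simp: UNIV_Times_UNIV)
  have Wt: "W (t x y) = t (\<rho> x) (\<sigma> y)" for x y
  proof (rule dense_span_cinner_ext[OF dense])
    fix z assume "z \<in> {t x y |x y. True}"
    then obtain x' y' where z: "z = t x' y'" by blast
    have "((\<lambda>p. cinner z (?g p) * cinner (?g p) (t x y)) has_sum cinner z (W (t x y))) (UNIV \<times> UNIV)"
      using W(2) by (simp add: gram_family_def UNIV_Times_UNIV)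
    hence "((\<lambda>k. cinner x' (v k) * cinner (v k) x * cinner y' (\<sigma> y)) has_sum cinner z (W (t x y))) UNIV"
    proof (rule has_sum_SigmaD)
      fix k
      have "((\<lambda>l. cinner x' (v k) * cinner (v k) x * (cinner y' (w l) * cinner (w l) y)) has_sum
          cinner x' (v k) * cinner (v k) x * cinner y' (\<sigma> y)) UNIV"
        by (intro has_sum_cmult_right hw)
      thus "((\<lambda>l. cinner z (?g (k, l)) * cinner (?g (k, l)) (t x y)) has_sum
          cinner x' (v k) * cinner (v k) x * cinner y' (\<sigma> y)) UNIV"
        by (simp add: z inner mult_ac)
    qed
    moreover have "((\<lambda>k. cinner x' (v k) * cinner (v k) x * cinner y' (\<sigma> y)) has_sum
        cinner x' (\<rho> x) * cinner y' (\<sigma> y)) UNIV"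
      by (intro has_sum_cmult_left hv)
    ultimately show "cinner z (W (t x y)) = cinner z (t (\<rho> x) (\<sigma> y))"
      unfolding z inner by (rule has_sum_unique)
  qed
  have "tensor_op t \<rho> \<sigma> = W" by (rule tensor_op_eqI[OF W(1) Wt])
  thus "gram_family ?g (tensor_op t \<rho> \<sigma>)" "bounded_clinear (tensor_op t \<rho> \<sigma>)"
    "tensor_op t \<rho> \<sigma> (t x y) = t (\<rho> x) (\<sigma> y)"
    using W Wt by simp_all
qed

text \<open>The partial trace over the apparatus: the sum over \<open>l\<close> contributes the
  factor 1. Moments of system observables can thus be read off the composite state.\<close>

lemma gram_sum_marginal:
  fixes v :: "'i \<Rightarrow> 'h" and w :: "'j \<Rightarrow> 'k"
  assumes onb: "\<exists>E :: 'hk set. is_onb E" and v: "gram_family v \<rho>" and w: "gram_family w \<sigma>"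
    and one: "((\<lambda>l. (norm (w l))\<^sup>2) has_sum 1) UNIV"
    and A: "bounded_clinear A" and B: "bounded_clinear B"
  shows "(\<Sum>\<^sub>\<infinity>(k, l). cinner (tensor_op t A id (t (v k) (w l))) (tensor_op t B id (t (v k) (w l))))
    = (\<Sum>\<^sub>\<infinity>k. cinner (A (v k)) (B (v k)))"
proof -
  let ?S = "\<Sum>\<^sub>\<infinity>(k, l). cinner (tensor_op t A id (t (v k) (w l))) (tensor_op t B id (t (v k) (w l)))"
  have "((\<lambda>(k, l). cinner (tensor_op t A id (t (v k) (w l))) (tensor_op t B id (t (v k) (w l))))
      has_sum ?S) (UNIV \<times> UNIV)"
    using gram_family_has_sum[OF onb gram_family_tensor(1)[OF v w] tensor_op_left(1)[OF A]
        tensor_op_left(1)[OF B]]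
    by (simp add: split_beta' UNIV_Times_UNIV)
  hence "((\<lambda>k. cinner (A (v k)) (B (v k))) has_sum ?S) UNIV"
  proof (rule has_sum_SigmaD)
    fix k
    have "((\<lambda>l. cinner (A (v k)) (B (v k)) * complex_of_real ((norm (w l))\<^sup>2)) has_sum
        cinner (A (v k)) (B (v k)) * of_real 1) UNIV"
      by (intro has_sum_cmult_right has_sum_of_real one)
    thus "((\<lambda>l. case (k, l) of (k, l) \<Rightarrow>
        cinner (tensor_op t A id (t (v k) (w l))) (tensor_op t B id (t (v k) (w l))))
      has_sum cinner (A (v k)) (B (v k))) UNIV"
      by (simp add: tensor_op_left A B inner cinner_norm)
  qed
  thus ?thesis by (simp add: infsumI)
qed

end

section \<open>Extremal eigenvalues of states\<close>

lemma finite_onb_expansion: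
  assumes "is_onb E" "finite E"
  shows "x = (\<Sum>e\<in>E. cinner e x *\<^sub>C e)"
proof -
  have "(\<Sum>e\<in>E. (cmod (cinner e x))\<^sup>2) = (norm x)\<^sup>2"
    using onb_Parseval_diag[OF assms(1), of x] assms(2) by (simp add: has_sum_finite_iff)
  thus ?thesis
    using finite_onb_distance[OF assms(1,2) subset_refl, of x "\<lambda>e. cinner e x"] by simp
qed

text \<open>Translates the case distinction in \<open>smallest_eigenvalue\<close> into a property of
  the basis at hand.\<close>

lemma finite_onb_iff_finite_dimensional:
  assumes E: "is_onb (E :: 'a::complex_hilbert_space set)"
  shows "finite E \<longleftrightarrow> (\<exists>S :: 'a set. finite S \<and> complex_vector.span S = UNIV)"
proof
  assume fin: "finite E"
  have "x \<in> complex_vector.span E" for x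
    by (subst finite_onb_expansion[OF E fin, of x])
      (intro complex_vector.span_sum complex_vector.span_scale complex_vector.span_base)
  thus "\<exists>S :: 'a set. finite S \<and> complex_vector.span S = UNIV" using fin by blast
next
  assume "\<exists>S :: 'a set. finite S \<and> complex_vector.span S = UNIV"
  then obtain S :: "'a set" where S: "finite S" "complex_vector.span S = UNIV" by blast
  have "complex_vector.independent E"
    unfolding complex_vector.independent_explicit_module
  proof (intro allI impI)
    fix F :: "'a set" and c e
    assume F: "finite F" "F \<subseteq> E" "(\<Sum>v\<in>F. c v *\<^sub>C v) = 0" "e \<in> F"
    have "(\<Sum>e\<in>F. (cmod (c e))\<^sup>2) = 0"
      using finite_onb_distance[OF E F(1,2), of 0 c] F(3) by simp
    thus "c e = 0" using F(1,4) by (simp add: sum_nonneg_eq_0_iff)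
  qed
  thus "finite E" using complex_vector.independent_span_bound[OF S(1)] S(2) by auto
qed

lemma bounded_linear_scaleC_left: "bounded_linear (\<lambda>c. c *\<^sub>C e)"
  by (rule bounded_linear_intro[of _ "norm e"])
    (simp_all add: scaleC_add_left scaleR_scaleC scaleC_scaleC scaleR_conv_of_real norm_scaleC)

text \<open>A Minkowski sum of compact discs, one vector at a time. For a finite orthonormal basis
  the unit sphere is a closed subset of such a \<open>K\<close>, hence compact.\<close>

lemma bounded_coefficients_in_compact:
  fixes F :: "'a::complex_hilbert_space set"
  assumes "finite F"
  shows "\<exists>K. compact K \<and> (\<forall>c. (\<forall>e\<in>F. cmod (c e) \<le> 1) \<longrightarrow> (\<Sum>e\<in>F. c e *\<^sub>C e) \<in> K)"
  using assms
proof (induction F rule: finite_induct)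
  case empty
  show ?case by (rule exI[of _ "{0}"]) simp
next
  case (insert e F)
  then obtain K where K: "compact K" "\<And>c. (\<forall>e\<in>F. cmod (c e) \<le> 1) \<Longrightarrow> (\<Sum>e\<in>F. c e *\<^sub>C e) \<in> K"
    by blast
  let ?D = "(\<lambda>c. c *\<^sub>C e) ` cball 0 1"
  have "compact ?D"
    by (intro compact_continuous_image linear_continuous_on bounded_linear_scaleC_left compact_cball)
  hence "compact {x + y |x y. x \<in> ?D \<and> y \<in> K}" using K(1) by (rule compact_sums)
  moreover have "(\<Sum>e\<in>insert e F. c e *\<^sub>C e) \<in> {x + y |x y. x \<in> ?D \<and> y \<in> K}"
    if c: "\<forall>e\<in>insert e F. cmod (c e) \<le> 1" for c
  proof -
    have "c e *\<^sub>C e \<in> ?D" "(\<Sum>e\<in>F. c e *\<^sub>C e) \<in> K" using c K(2)[of c] by auto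
    thus ?thesis using insert by auto
  qed
  ultimately show ?case by blast
qed

lemma compact_sphere_finite_onb:
  assumes E: "is_onb (E :: 'a::complex_hilbert_space set)" and "finite E"
  shows "compact {x :: 'a. norm x = 1}"
proof -
  obtain K where K: "compact K" "\<And>c. (\<forall>e\<in>E. cmod (c e) \<le> 1) \<Longrightarrow> (\<Sum>e\<in>E. c e *\<^sub>C e) \<in> K"
    using bounded_coefficients_in_compact[OF \<open>finite E\<close>] by blast
  have "x \<in> K" if "norm x = 1" for x
  proof -
    have "\<forall>e\<in>E. cmod (cinner e x) \<le> 1"
      using cinner_Cauchy_Schwarz[of _ x] that E by (metis is_onb_def mult_1)
    thus ?thesis by (subst finite_onb_expansion[OF assms, of x]) (rule K(2))
  qed
  hence eq: "{x. norm x = 1} \<inter> K = {x. norm x = 1}" by auto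
  have "closed {x :: 'a. norm x = 1}" by (intro closed_Collect_eq continuous_intros)
  from closed_Int_compact[OF this K(1)] show ?thesis unfolding eq .
qed

lemma hermitian_eigenvalue_max:
  fixes T :: "'a::complex_hilbert_space \<Rightarrow> 'a"
  assumes T: "hermitian T" and E: "is_onb (E :: 'a set)" "finite E" and "z \<noteq> (0 :: 'a)"
  obtains a where "eigenvalue T (of_real a)" "\<And>x. Re (cinner x (T x)) \<le> a * (norm x)\<^sup>2"
proof -
  have blT: "bounded_clinear T" using T by (simp add: hermitian_def)
  have "z /\<^sub>R norm z \<in> {x. norm x = 1}" using \<open>z \<noteq> 0\<close> by simp
  hence "{x :: 'a. norm x = 1} \<noteq> {}" by blast
  moreover have "continuous_on {x. norm x = 1} (\<lambda>x. Re (cinner x (T x)))"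
    by (intro continuous_intros bounded_clinear_continuous_on blT)
  ultimately have "\<exists>x0\<in>{x. norm x = 1}. \<forall>x\<in>{x. norm x = 1}.
      Re (cinner x (T x)) \<le> Re (cinner x0 (T x0))"
    by (rule continuous_attains_sup[OF compact_sphere_finite_onb[OF E]])
  then obtain x0 where x0: "norm x0 = 1"
      "\<And>x. norm x = 1 \<Longrightarrow> Re (cinner x (T x)) \<le> Re (cinner x0 (T x0))"
    by blast
  define a where "a = Re (cinner x0 (T x0))"
  have le: "Re (cinner x (T x)) \<le> a * (norm x)\<^sup>2" for x
  proof (cases "x = 0")
    case False
    let ?c = "complex_of_real (1 / norm x)"
    have "Re (cinner (?c *\<^sub>C x) (T (?c *\<^sub>C x))) \<le> a"
      unfolding a_def by (rule x0(2)) (use False in \<open>simp add: norm_scaleC norm_divide\<close>)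
    moreover have "cinner (?c *\<^sub>C x) (T (?c *\<^sub>C x)) = of_real (1 / (norm x)\<^sup>2) * cinner x (T x)"
      by (simp add: bounded_clinearD[OF blT] cinner.scaleC_left cinner.scaleC_right power2_eq_square)
    ultimately have "Re (of_real (1 / (norm x)\<^sup>2) * cinner x (T x)) \<le> a" by simp
    hence "1 / (norm x)\<^sup>2 * Re (cinner x (T x)) \<le> a"
      unfolding times_complex.sel Re_complex_of_real Im_complex_of_real by simp
    thus ?thesis using False by (simp add: field_simps)
  qed simp
  \<comment> \<open>The maximum \<open>a\<close> of the Rayleigh quotient is an eigenvalue: the form
    of the positive operator \<open>a - T\<close> vanishes at \<open>x0\<close>, so this operator
    annihilates \<open>x0\<close>.\<close>
  let ?Q = "\<lambda>x. of_real a *\<^sub>C x - T x"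
  have "positive_op ?Q"
    unfolding positive_op_iff hermitian_def
    using T le by (auto intro!: bounded_clinear_diff bounded_clinear_scaleC blT
        simp: cinner.diff_left cinner.diff_right cinner.scaleC_left cinner.scaleC_right
          hermitian_def cinner_norm)
  moreover have "Re (cinner x0 (?Q x0)) = 0"
    by (simp add: cinner.diff_right cinner.scaleC_right cinner_norm x0(1) a_def)
  ultimately have "?Q x0 = 0"
    using positive_op_bound[of ?Q] by (metis mult_zero_right norm_eq_zero power2_less_eq_zero_iff)
  hence "eigenvalue T (of_real a)"
    unfolding eigenvalue_def using x0(1) by (intro exI[of _ x0]) auto
  thus ?thesis using that le by blast
qed

lemma state_nonzero:
  fixes \<rho> :: "'a::complex_hilbert_space \<Rightarrow> 'a"
  assumes "state \<rho>"
  obtains z :: 'a where "z \<noteq> 0"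
proof (rule ccontr)
  assume "\<not> thesis"
  hence "cinner x y = 0" for x y :: 'a using that cinner.zero_left by metis
  hence "op_trace \<rho> = 0" by (simp add: op_trace_def)
  thus False using assms by (simp add: state_def)
qed

lemma finite_dimensional_state_eigenvalues:
  fixes \<rho> :: "'a::complex_hilbert_space \<Rightarrow> 'a"
  assumes \<rho>: "state \<rho>" and fd: "\<exists>S :: 'a set. finite S \<and> complex_vector.span S = UNIV"
  shows "0 \<le> smallest_eigenvalue \<rho>"
    and "smallest_eigenvalue \<rho> * (norm x)\<^sup>2 \<le> Re (cinner x (\<rho> x))"
    and "Re (cinner x (\<rho> x)) \<le> largest_eigenvalue \<rho> * (norm x)\<^sup>2"
    and "smallest_eigenvalue \<rho> \<le> largest_eigenvalue \<rho>"
proof -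
  obtain E :: "'a set" where E: "is_onb E" using state_onb[OF \<rho>] by blast
  hence fin: "finite E" using fd finite_onb_iff_finite_dimensional by blast
  obtain z :: 'a where z: "z \<noteq> 0" by (rule state_nonzero[OF \<rho>])
  have h: "hermitian \<rho>" and pos: "\<And>x. 0 \<le> Re (cinner x (\<rho> x))"
    using \<rho> by (auto simp: state_def positive_op_iff)
  \<comment> \<open>The least eigenvalue will be the negated maximum for \<open>- \<rho>\<close>;
    writing zero as \<open>0 *\<^sub>C x\<close> makes the rule for differences applicable.\<close>
  have "bounded_clinear (\<lambda>x. 0 *\<^sub>C x - \<rho> x)"
    using h by (intro bounded_clinear_diff bounded_clinear_scaleC) (simp add: hermitian_def)
  hence h': "hermitian (\<lambda>x. 0 - \<rho> x)"
    using h by (simp add: hermitian_def cinner.minus_left cinner.minus_right)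
  have ev: "\<exists>y. y \<noteq> 0 \<and> Re (cinner y (T y)) = r * (norm y)\<^sup>2" if r: "eigenvalue T (of_real r)"
    for T :: "'a \<Rightarrow> 'a" and r
  proof -
    obtain y where "y \<noteq> 0" "T y = of_real r *\<^sub>C y" using r by (auto simp: eigenvalue_def)
    thus ?thesis by (intro exI[of _ y]) (simp add: cinner.scaleC_right cinner_norm)
  qed
  obtain a where a: "eigenvalue \<rho> (of_real a)" "\<And>x. Re (cinner x (\<rho> x)) \<le> a * (norm x)\<^sup>2"
    using hermitian_eigenvalue_max[OF h E fin z] by blast
  obtain b where b: "eigenvalue (\<lambda>x. 0 - \<rho> x) (of_real b)"
      "\<And>x. Re (cinner x (0 - \<rho> x)) \<le> b * (norm x)\<^sup>2"
    using hermitian_eigenvalue_max[OF h' E fin z] by blast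
  have b1: "eigenvalue \<rho> (of_real (- b))"
  proof -
    obtain y where y: "y \<noteq> 0" "- \<rho> y = of_real b *\<^sub>C y" using b(1) by (auto simp: eigenvalue_def)
    have "\<rho> y = - (- \<rho> y)" by simp
    also have "\<dots> = of_real (- b) *\<^sub>C y" unfolding y(2) by simp
    finally show ?thesis using y(1) by (auto simp: eigenvalue_def)
  qed
  have b2: "- b * (norm x)\<^sup>2 \<le> Re (cinner x (\<rho> x))" for x
    using b(2)[of x] by (simp add: cinner.minus_right)
  have "largest_eigenvalue \<rho> = a"
    unfolding largest_eigenvalue_def
  proof (rule Greatest_equality)
    show "eigenvalue \<rho> (of_real a)" by (rule a(1))
  next
    fix r assume "eigenvalue \<rho> (of_real r)"
    then obtain y where "y \<noteq> 0" "Re (cinner y (\<rho> y)) = r * (norm y)\<^sup>2" using ev by blast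
    thus "r \<le> a" using a(2)[of y] by simp
  qed
  moreover have "smallest_eigenvalue \<rho> = - b"
    unfolding smallest_eigenvalue_def if_P[OF fd]
  proof (rule Least_equality)
    show "eigenvalue \<rho> (of_real (- b))" by (rule b1)
  next
    fix r assume "eigenvalue \<rho> (of_real r)"
    then obtain y where y: "y \<noteq> 0" "Re (cinner y (\<rho> y)) = r * (norm y)\<^sup>2" using ev by blast
    hence "- b * (norm y)\<^sup>2 \<le> r * (norm y)\<^sup>2" using b2[of y] by simp
    thus "- b \<le> r" using y(1) by (simp only: mult_le_cancel_right) simp
  qed
  ultimately show "smallest_eigenvalue \<rho> * (norm x)\<^sup>2 \<le> Re (cinner x (\<rho> x))"
    and "Re (cinner x (\<rho> x)) \<le> largest_eigenvalue \<rho> * (norm x)\<^sup>2" for x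
    using a b2 by simp_all
  note bounds = this
  obtain y where "y \<noteq> 0" "Re (cinner y (\<rho> y)) = smallest_eigenvalue \<rho> * (norm y)\<^sup>2"
    using ev b1 \<open>smallest_eigenvalue \<rho> = - b\<close> by metis
  thus "0 \<le> smallest_eigenvalue \<rho>" "smallest_eigenvalue \<rho> \<le> largest_eigenvalue \<rho>"
    using pos[of y] bounds(2)[of y] by (simp_all add: zero_le_mult_iff)
qed

text \<open>\<open>T x + s x = y\<close> is a fixed-point equation for the contraction
  \<open>x \<mapsto> (y + (C - T) x) / (s + C)\<close>, where \<open>0 \<le> C - T \<le> C\<close>.\<close>

lemma positive_op_add_scalar_invertible:
  fixes T :: "'a::complex_hilbert_space \<Rightarrow> 'a"
  assumes T: "positive_op T" and s: "0 < s"
  obtains S where "bounded_clinear S" "\<And>x. S (T x + complex_of_real s *\<^sub>C x) = x"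
    "\<And>x. T (S x) + complex_of_real s *\<^sub>C S x = x"
proof -
  define G where "G = (\<lambda>x. T x + complex_of_real s *\<^sub>C x)"
  have blT: "bounded_clinear T" and pos: "\<And>x. 0 \<le> Re (cinner x (T x))"
    using T by (auto simp: positive_op_iff hermitian_def)
  obtain C where C: "0 < C" "\<And>x. Re (cinner x (T x)) \<le> C * (norm x)\<^sup>2"
    using positive_op_bound[OF T] by metis
  define Q where "Q = (\<lambda>x. complex_of_real C *\<^sub>C x - T x)"
  have blQ: "bounded_clinear Q" unfolding Q_def by (intro bounded_clinear_diff bounded_clinear_scaleC blT)
  have Qle: "Re (cinner x (Q x)) \<le> C * (norm x)\<^sup>2" for x
    using pos[of x] by (simp add: Q_def cinner.diff_right cinner.scaleC_right cinner_norm)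
  have posQ: "positive_op Q"
    unfolding positive_op_iff hermitian_def
    using blQ T C(2) by (auto simp: Q_def cinner.diff_left cinner.diff_right cinner.scaleC_left
        cinner.scaleC_right cinner_norm positive_op_iff hermitian_def)
  have Qnorm: "norm (Q x) \<le> C * norm x" for x
  proof -
    have "(norm (Q x))\<^sup>2 \<le> C * Re (cinner x (Q x))" by (rule positive_op_norm_le[OF posQ Qle])
    also have "\<dots> \<le> C * (C * (norm x)\<^sup>2)" using C(1) Qle by (intro mult_left_mono) auto
    finally have "(norm (Q x))\<^sup>2 \<le> (C * norm x)\<^sup>2" by (simp add: power2_eq_square mult_ac)
    thus ?thesis using C(1) by (auto intro: power2_le_imp_le)
  qed
  have ex1: "\<exists>!x. G x = y" for y
  proof -
    define k where "k = complex_of_real (1 / (s + C))"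
    define f where "f x = k *\<^sub>C (y + Q x)" for x
    have "dist (f x) (f x') \<le> C / (s + C) * dist x x'" for x x'
    proof -
      have "f x - f x' = k *\<^sub>C Q (x - x')"
        by (simp add: f_def bounded_clinear_simps[OF blQ] complex_vector.scale_right_diff_distrib[symmetric])
      hence "dist (f x) (f x') = 1 / (s + C) * norm (Q (x - x'))"
        using s C(1) by (simp add: dist_norm norm_scaleC k_def norm_divide
            del: of_real_add of_real_divide)
      also have "\<dots> \<le> 1 / (s + C) * (C * norm (x - x'))"
        using s C(1) by (intro mult_left_mono Qnorm) simp
      finally show ?thesis by (simp add: dist_norm)
    qed
    hence "\<exists>!x. f x = x"
      using s C(1) by (intro banach_fix_type[of "C / (s + C)"]) auto
    moreover have "f x = x \<longleftrightarrow> G x = y" for x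
    proof -
      have "f x = x \<longleftrightarrow> y + Q x = complex_of_real (s + C) *\<^sub>C x"
      proof
        assume "f x = x"
        hence "complex_of_real (s + C) *\<^sub>C x = (complex_of_real (s + C) * k) *\<^sub>C (y + Q x)"
          by (metis f_def scaleC_scaleC)
        thus "y + Q x = complex_of_real (s + C) *\<^sub>C x"
          using s C(1) by (simp add: k_def of_real_mult[symmetric] del: of_real_mult of_real_add of_real_divide)
      next
        assume "y + Q x = complex_of_real (s + C) *\<^sub>C x"
        thus "f x = x"
          using s C(1) by (simp add: f_def scaleC_scaleC k_def of_real_mult[symmetric]
              del: of_real_mult of_real_add of_real_divide)
      qed
      also have "\<dots> \<longleftrightarrow> G x = y" by (auto simp: Q_def G_def scaleC_add_left algebra_simps)
      finally show ?thesis .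
    qed
    ultimately show ?thesis by simp
  qed
  define S where "S y = (THE x. G x = y)" for y
  have GS: "G (S y) = y" for y unfolding S_def by (rule theI'[OF ex1])
  have SG: "S (G x) = x" for x unfolding S_def by (rule the1_equality[OF ex1 refl])
  have S_unique: "S y = x" if "G x = y" for x y using SG that by blast
  have addG: "G (x + y) = G x + G y" "G (c *\<^sub>C x) = c *\<^sub>C G x" for c x y
    by (simp_all add: G_def bounded_clinearD[OF blT] scaleC_add_right scaleC_scaleC mult.commute)
  \<comment> \<open>Coercivity, \<open>s * (norm x)\<^sup>2 \<le> Re (cinner x (G x))\<close>, taken
    at \<open>x = S y\<close>.\<close>
  have "norm (S y) \<le> norm y * (1 / s)" for y
  proof (cases "S y = 0")
    case False
    have "s * (norm (S y))\<^sup>2 \<le> Re (cinner (S y) (G (S y)))"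
      using pos[of "S y"] by (simp add: G_def cinner.add_right cinner.scaleC_right cinner_norm)
    also have "\<dots> \<le> norm (S y) * norm y"
      unfolding GS using complex_Re_le_cmod cinner_Cauchy_Schwarz order_trans by blast
    finally have "norm (S y) * (s * norm (S y)) \<le> norm (S y) * norm y"
      by (simp add: power2_eq_square mult_ac)
    hence "s * norm (S y) \<le> norm y" using False by simp
    thus ?thesis using s by (simp add: field_simps)
  qed (use s in simp)
  hence "bounded_clinear S" unfolding bounded_clinear_def
    by (intro conjI allI S_unique exI[of _ "1 / s"]) (simp_all add: addG GS)
  thus ?thesis using that SG GS by (simp add: G_def)
qed

text \<open>A bounded inverse would keep all diagonal entries above one positive number, which a
  finite trace forbids on an infinite basis; so 0 is spectral. Positivity keeps negative reals out
  of the spectrum.\<close>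

lemma infinite_dimensional_state_smallest_eigenvalue:
  fixes \<rho> :: "'a::complex_hilbert_space \<Rightarrow> 'a"
  assumes \<rho>: "state \<rho>" and infd: "\<not> (\<exists>S :: 'a set. finite S \<and> complex_vector.span S = UNIV)"
  shows "smallest_eigenvalue \<rho> = 0"
proof -
  have pos: "positive_op \<rho>" using \<rho> by (simp add: state_def)
  have no_neg: "0 \<le> r" if "complex_of_real r \<in> spectrum \<rho>" for r
  proof (rule ccontr)
    assume "\<not> 0 \<le> r"
    hence "0 < - r" by simp
    then obtain S where "bounded_clinear S" "\<And>x. S (\<rho> x + complex_of_real (- r) *\<^sub>C x) = x"
        "\<And>x. \<rho> (S x) + complex_of_real (- r) *\<^sub>C S x = x"
      using positive_op_add_scalar_invertible[OF pos] by blast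
    thus False using that unfolding spectrum_def by (auto simp: complex_vector.scale_minus_left)
  qed
  have zero: "complex_of_real 0 \<in> spectrum \<rho>"
  proof (rule ccontr)
    assume "complex_of_real 0 \<notin> spectrum \<rho>"
    then obtain S where S: "bounded_clinear S" "\<And>x. S (\<rho> x) = x" by (auto simp: spectrum_def)
    obtain K where K: "0 < K" "\<And>x. norm (S x) \<le> K * norm x" using bounded_clinear_bound[OF S(1)] by metis
    obtain C where C: "0 < C" "\<And>x. (norm (\<rho> x))\<^sup>2 \<le> C * Re (cinner x (\<rho> x))"
      using positive_op_bound[OF pos] by metis
    obtain E where E: "is_onb E" "(\<lambda>e. cinner e (\<rho> e)) summable_on E" by (rule state_summable[OF \<rho>])
    have "infinite E" using infd finite_onb_iff_finite_dimensional[OF E(1)] by blast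
    \<comment> \<open>From \<open>1 \<le> K * norm (\<rho> e)\<close> and
      \<open>(norm (\<rho> e))\<^sup>2 \<le> C * Re (cinner e (\<rho> e))\<close>.\<close>
    define \<delta> where "\<delta> = 1 / (K\<^sup>2 * C)"
    have \<delta>: "0 < \<delta>" using K(1) C(1) by (simp add: \<delta>_def)
    have ge: "\<delta> \<le> Re (cinner e (\<rho> e))" if "e \<in> E" for e
    proof -
      have "1 \<le> K * norm (\<rho> e)" using K(2)[of "\<rho> e"] S(2)[of e] that E(1) by (simp add: is_onb_def)
      hence "1 \<le> (K * norm (\<rho> e))\<^sup>2" by simp
      also have "\<dots> \<le> K\<^sup>2 * (C * Re (cinner e (\<rho> e)))"
        unfolding power_mult_distrib by (intro mult_left_mono C) simp
      finally show ?thesis using K(1) C(1) by (simp add: \<delta>_def field_simps)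
    qed
    define M where "M = (\<Sum>\<^sub>\<infinity>e\<in>E. Re (cinner e (\<rho> e)))"
    obtain n :: nat where n: "M < real n * \<delta>" using \<delta> reals_Archimedean3 by blast
    obtain F where F: "F \<subseteq> E" "finite F" "card F = n"
      using infinite_arbitrarily_large[OF \<open>infinite E\<close>] by blast
    have "real n * \<delta> \<le> (\<Sum>e\<in>F. Re (cinner e (\<rho> e)))"
      using sum_mono[of F "\<lambda>_. \<delta>" "\<lambda>e. Re (cinner e (\<rho> e))"] ge F by auto
    also have "\<dots> \<le> M"
      unfolding M_def
      by (rule finite_sum_le_infsum[OF summable_on_Re[OF E(2)] F(2,1)]) (use ge \<delta> in force)
    finally show False using n by simp
  qed
  show ?thesis unfolding smallest_eigenvalue_def if_not_P[OF infd]
    by (rule cInf_eq_minimum) (use zero no_neg in auto)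
qed

section \<open>Weighted uncertainty relations\<close>

text \<open>For a Gram family of \<open>R\<close> this is the trace of \<open>R\<close> times the
  adjoint of \<open>X\<close> times \<open>Y\<close>, the GNS inner product of \<open>X\<close> and
  \<open>Y\<close>.\<close>

definition gram_inner ::
  "('i \<Rightarrow> 'a::complex_hilbert_space) \<Rightarrow> ('a \<Rightarrow> 'a) \<Rightarrow> ('a \<Rightarrow> 'a) \<Rightarrow> complex" where
  "gram_inner g X Y = (\<Sum>\<^sub>\<infinity>i. cinner (X (g i)) (Y (g i)))"

text \<open>Valid for every \<open>f\<close>: both sums are 0 when \<open>f\<close> is not
  summable.\<close>

lemma infsum_complex_of_real: "(\<Sum>\<^sub>\<infinity>i\<in>I. complex_of_real (f i)) = complex_of_real (infsum f I)"
proof (rule infsum_bounded_linear_strong[OF _ bounded_linear_of_real])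
  show "(\<lambda>i. complex_of_real (f i)) summable_on I \<longleftrightarrow> f summable_on I"
    using summable_on_Re[of "\<lambda>i. complex_of_real (f i)" I] summable_on_of_real[of f I] by auto
qed

lemma gram_inner_self:
  "Re (gram_inner g X X) = (\<Sum>\<^sub>\<infinity>i. (norm (X (g i)))\<^sup>2)" "0 \<le> Re (gram_inner g X X)"
proof -
  have "gram_inner g X X = (\<Sum>\<^sub>\<infinity>i. complex_of_real ((norm (X (g i)))\<^sup>2))"
    by (simp only: gram_inner_def cinner_norm)
  also have "\<dots> = complex_of_real (\<Sum>\<^sub>\<infinity>i. (norm (X (g i)))\<^sup>2)" by (rule infsum_complex_of_real)
  finally show "Re (gram_inner g X X) = (\<Sum>\<^sub>\<infinity>i. (norm (X (g i)))\<^sup>2)" by simp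
  thus "0 \<le> Re (gram_inner g X X)" by (simp add: infsum_nonneg)
qed

text \<open>The origin of the constant. The hypothesis rearranges to
  \<open>2 * s * (L + l) * m \<le> (L - l) * (a + s\<^sup>2 * b)\<close> for all real
  \<open>s\<close>, and the discriminant bounds \<open>m\<close>. For \<open>l = 0\<close> the
  factor is 1/2, as in Robertson's inequality.\<close>

lemma tilted_quadratic_bound:
  fixes a b m l L :: real
  assumes "0 \<le> a" "0 \<le> b" "0 \<le> l" "l < L"
    and *: "\<And>s. l * (a + s\<^sup>2 * b + 2 * s * m) \<le> L * (a + s\<^sup>2 * b - 2 * s * m)"
  shows "(L + l) / (2 * (L - l)) * \<bar>2 * m\<bar> \<le> sqrt a * sqrt b"
proof -
  define q where "q = (L + l) * m / (L - l)"
  have q: "2 * s * q \<le> a + s\<^sup>2 * b" for s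
  proof -
    have "(L - l) * (2 * s * q) = 2 * s * (L + l) * m" using assms(4) by (simp add: q_def)
    also have "\<dots> \<le> (L - l) * (a + s\<^sup>2 * b)" using *[of s] by (simp add: algebra_simps)
    finally show ?thesis using assms(4) by simp
  qed
  have "q\<^sup>2 \<le> a * b"
  proof (cases "b = 0")
    case True
    have "q = 0"
    proof (rule ccontr)
      assume "q \<noteq> 0"
      thus False using q[of "(a + 1) / (2 * q)"] True by simp
    qed
    thus ?thesis using True by simp
  next
    case False
    hence "0 < b" using assms(2) by simp
    \<comment> \<open>The minimizer of \<open>a + s\<^sup>2 * b - 2 * s * q\<close>.\<close>
    thus ?thesis using q[of "q / b"] by (simp add: field_simps power2_eq_square)
  qed
  hence "\<bar>q\<bar> \<le> sqrt a * sqrt b"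
    using real_sqrt_le_mono by (fastforce simp: real_sqrt_mult)
  moreover have "\<bar>q\<bar> = (L + l) * \<bar>m\<bar> / (L - l)"
    using assms(3,4) by (simp add: q_def abs_mult)
  hence "(L + l) / (2 * (L - l)) * \<bar>2 * m\<bar> = \<bar>q\<bar>"
    using assms(4) by (simp add: abs_mult divide_simps) (simp add: algebra_simps)
  ultimately show ?thesis by simp
qed

text \<open>With \<open>Z'\<close> the adjoint of \<open>Z\<close>, the two sides are traces of
  \<open>R Z Z'\<close> and of \<open>R Z' Z\<close>. The ratio of \<open>l\<close> to
  \<open>L\<close> measures how far \<open>R\<close> is from being tracial: in finite dimension a
  positive multiple of the identity admits \<open>l = L\<close>.\<close>

definition tilted :: "('i \<Rightarrow> 'a::complex_hilbert_space) \<Rightarrow> real \<Rightarrow> real \<Rightarrow> bool" where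
  "tilted g l L \<longleftrightarrow> (\<forall>Z Z'. bounded_clinear Z \<longrightarrow> bounded_clinear Z' \<longrightarrow>
     (\<forall>x y. cinner (Z' x) y = cinner x (Z y)) \<longrightarrow>
     l * Re (gram_inner g Z' Z') \<le> L * Re (gram_inner g Z Z))"

text \<open>The tilting inequality is used for \<open>Z = X + isY\<close> with all real \<open>s\<close>.\<close>

lemma weighted_Robertson:
  fixes g :: "'i \<Rightarrow> 'a::complex_hilbert_space"
  assumes onb: "\<exists>E :: 'a set. is_onb E" and g: "gram_family g R"
    and "0 \<le> l" "l < L" and tilted: "tilted g l L"
    and X: "hermitian X" and Y: "hermitian Y"
  shows "(L + l) / (2 * (L - l)) * \<bar>2 * Im (gram_inner g X Y)\<bar>
    \<le> sqrt (Re (gram_inner g X X)) * sqrt (Re (gram_inner g Y Y))"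
proof (rule tilted_quadratic_bound)
  fix s :: real
  have bl: "bounded_clinear X" "bounded_clinear Y" using X Y by (auto simp: hermitian_def)
  have hs: "((\<lambda>i. cinner (V (g i)) (W (g i))) has_sum gram_inner g V W) UNIV"
    if "bounded_clinear V" "bounded_clinear W" for V W
    unfolding gram_inner_def by (rule gram_family_has_sum[OF onb g that])
  \<comment> \<open>This is \<open>X + \<i> r Y\<close>, written as a difference for
    \<open>bounded_clinear_diff\<close>; changing the sign of \<open>r\<close> gives the
    adjoint.\<close>
  define Z where "Z r = (\<lambda>x. X x - (- \<i> * complex_of_real r) *\<^sub>C Y x)" for r
  have blZ: "bounded_clinear (Z r)" for r
    unfolding Z_def by (intro bounded_clinear_diff bl bounded_clinear_compose[OF bounded_clinear_scaleC])
  have adj: "cinner (Z (- s) x) y = cinner x (Z s y)" for x y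
    using X Y by (simp add: Z_def hermitian_def cinner.diff_left cinner.diff_right
        cinner.scaleC_left cinner.scaleC_right cinner.add_right)
  have Z: "Re (gram_inner g (Z r) (Z r))
      = Re (gram_inner g X X) + r\<^sup>2 * Re (gram_inner g Y Y) - 2 * r * Im (gram_inner g X Y)" for r
  proof -
    have "((\<lambda>i. Re (cinner (X (g i)) (X (g i))) + r\<^sup>2 * Re (cinner (Y (g i)) (Y (g i)))
        + (- 2 * r) * Im (cinner (X (g i)) (Y (g i)))) has_sum
       (Re (gram_inner g X X) + r\<^sup>2 * Re (gram_inner g Y Y) + (- 2 * r) * Im (gram_inner g X Y))) UNIV"
      by (intro has_sum_add has_sum_cmult_right has_sum_Re has_sum_Im hs bl)
    moreover have "Re (cinner (X x) (X x)) + r\<^sup>2 * Re (cinner (Y x) (Y x))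
        + (- 2 * r) * Im (cinner (X x) (Y x)) = Re (cinner (Z r x) (Z r x))" for x
      using cinner_commute[of "Y x" "X x"]
      by (simp add: Z_def cinner.add_left cinner.add_right cinner.scaleC_left cinner.scaleC_right
          power2_eq_square algebra_simps del: Re_cinner_self)
    ultimately have "((\<lambda>i. Re (cinner (Z r (g i)) (Z r (g i)))) has_sum
       (Re (gram_inner g X X) + r\<^sup>2 * Re (gram_inner g Y Y) + (- 2 * r) * Im (gram_inner g X Y))) UNIV"
      by simp
    from has_sum_unique[OF has_sum_Re[OF hs[OF blZ blZ]] this] show ?thesis by simp
  qed
  show "l * (Re (gram_inner g X X) + s\<^sup>2 * Re (gram_inner g Y Y) + 2 * s * Im (gram_inner g X Y))
      \<le> L * (Re (gram_inner g X X) + s\<^sup>2 * Re (gram_inner g Y Y) - 2 * s * Im (gram_inner g X Y))"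
    using tilted[unfolded tilted_def, rule_format, OF blZ blZ adj] by (simp add: Z)
qed (use assms gram_inner_self in auto)

text \<open>Cyclicity of the trace: both sides equal the double sum of
  \<open>(cmod (cinner (Z e) (g i)))\<^sup>2\<close>.\<close>

lemma gram_inner_finite_onb:
  fixes g :: "'i \<Rightarrow> 'a::complex_hilbert_space"
  assumes E: "is_onb (E :: 'a set)" "finite E" and g: "gram_family g R"
    and adj: "\<And>x y. cinner (Z' x) y = cinner x (Z y)"
  shows "Re (gram_inner g Z' Z') = (\<Sum>e\<in>E. Re (cinner (Z e) (R (Z e))))"
proof -
  have "((\<lambda>i. cinner (Z e) (g i) * cinner (g i) (Z e)) has_sum cinner (Z e) (R (Z e))) UNIV" for e
    using g by (simp add: gram_family_def)
  hence "((\<lambda>i. Re (cinner (Z e) (g i) * cinner (g i) (Z e))) has_sum Re (cinner (Z e) (R (Z e)))) UNIV" for e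
    by (rule has_sum_Re)
  moreover have "Re (cinner (Z e) x * cinner x (Z e)) = (cmod (cinner e (Z' x)))\<^sup>2" for e x
  proof -
    have "cinner e (Z' x) = cinner (Z e) x"
      using adj[of x e] by (metis cinner_commute)
    thus ?thesis using complex_norm_square[of "cinner (Z e) x"] cinner_commute[of x "Z e"]
      by (metis Re_complex_of_real)
  qed
  ultimately have "((\<lambda>i. (cmod (cinner e (Z' (g i))))\<^sup>2) has_sum Re (cinner (Z e) (R (Z e)))) UNIV" for e
    by simp
  hence "((\<lambda>i. \<Sum>e\<in>E. (cmod (cinner e (Z' (g i))))\<^sup>2) has_sum (\<Sum>e\<in>E. Re (cinner (Z e) (R (Z e))))) UNIV"
    by (intro has_sum_finite_sum E(2))
  moreover have "(\<Sum>e\<in>E. (cmod (cinner e x))\<^sup>2) = (norm x)\<^sup>2" for x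
    using onb_Parseval_diag[OF E(1), of x] E(2) by (simp add: has_sum_finite_iff)
  ultimately show ?thesis by (simp add: gram_inner_self infsumI)
qed

text \<open>Expanding in an orthonormal basis, \<open>Tr(R Z Z\<^sup>*) \<le> L Tr(Z Z\<^sup>*)\<close> and \<open>l Tr(Z\<^sup>* Z) \<le> Tr(R Z\<^sup>* Z)\<close>.\<close>

lemma tilted_finite_dimensional:
  fixes g :: "'i \<Rightarrow> 'a::complex_hilbert_space"
  assumes E: "is_onb (E :: 'a set)" "finite E" and g: "gram_family g R"
    and l: "0 \<le> l" "0 \<le> L"
    and lower: "\<And>x. l * (norm x)\<^sup>2 \<le> Re (cinner x (R x))"
    and upper: "\<And>x. Re (cinner x (R x)) \<le> L * (norm x)\<^sup>2"
  shows "tilted g l L"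
  unfolding tilted_def
proof (intro allI impI)
  fix Z Z' :: "'a \<Rightarrow> 'a" assume "\<forall>x y. cinner (Z' x) y = cinner x (Z y)"
  hence adj: "cinner (Z' x) y = cinner x (Z y)" for x y by blast
  have adj': "cinner (Z x) y = cinner x (Z' y)" for x y
    using adj[of y x] by (metis cinner_commute)
  have P: "(\<Sum>e\<in>E. (cmod (cinner e x))\<^sup>2) = (norm x)\<^sup>2" for x
    using onb_Parseval_diag[OF E(1), of x] E(2) by (simp add: has_sum_finite_iff)
  \<comment> \<open>\<open>Z\<close> and its adjoint have the same Hilbert-Schmidt norm, which links
    the upper bound used for one to the lower bound used for the other.\<close>
  have "(\<Sum>e\<in>E. (norm (Z e))\<^sup>2) = (\<Sum>e\<in>E. \<Sum>f\<in>E. (cmod (cinner f (Z e)))\<^sup>2)" by (simp add: P)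
  also have "\<dots> = (\<Sum>f\<in>E. \<Sum>e\<in>E. (cmod (cinner e (Z' f)))\<^sup>2)"
    by (subst sum.swap) (simp add: adj[symmetric] cinner.cmod_commute)
  also have "\<dots> = (\<Sum>e\<in>E. (norm (Z' e))\<^sup>2)" by (simp add: P)
  finally have HS: "(\<Sum>e\<in>E. (norm (Z e))\<^sup>2) = (\<Sum>e\<in>E. (norm (Z' e))\<^sup>2)" .
  have "l * Re (gram_inner g Z' Z') = l * (\<Sum>e\<in>E. Re (cinner (Z e) (R (Z e))))"
    by (simp add: gram_inner_finite_onb[OF E g adj])
  also have "\<dots> \<le> l * (\<Sum>e\<in>E. L * (norm (Z e))\<^sup>2)"
    by (intro mult_left_mono sum_mono upper l)
  also have "\<dots> = L * (\<Sum>e\<in>E. l * (norm (Z' e))\<^sup>2)"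
    by (simp add: sum_distrib_left[symmetric] HS)
  also have "\<dots> \<le> L * (\<Sum>e\<in>E. Re (cinner (Z' e) (R (Z' e))))"
    by (intro mult_left_mono sum_mono lower l)
  also have "\<dots> = L * Re (gram_inner g Z Z)"
    by (simp add: gram_inner_finite_onb[OF E g adj'])
  finally show "l * Re (gram_inner g Z' Z') \<le> L * Re (gram_inner g Z Z)" .
qed

lemma positive_form_diff_scalar:
  assumes "hermitian T" "\<And>x. c * (norm x)\<^sup>2 \<le> Re (cinner x (T x))"
  shows "positive_form (\<lambda>x y. cinner x (T y) - complex_of_real c * cinner x y)"
proof
  fix x y z :: 'a and d
  have T: "cinner (T x) y = cinner x (T y)" for x y
    using assms(1) by (simp add: hermitian_def)
  have "bounded_clinear T" using assms(1) by (simp add: hermitian_def)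
  note bl = bounded_clinearD[OF this]
  show "cinner x (T (y + z)) - of_real c * cinner x (y + z)
      = cinner x (T y) - of_real c * cinner x y + (cinner x (T z) - of_real c * cinner x z)"
    by (simp add: bl cinner.add_right algebra_simps)
  show "cinner x (T (d *\<^sub>C y)) - of_real c * cinner x (d *\<^sub>C y)
      = d * (cinner x (T y) - of_real c * cinner x y)"
    by (simp add: bl cinner.scaleC_right algebra_simps)
  show "cinner x (T y) - of_real c * cinner x y = cnj (cinner y (T x) - of_real c * cinner y x)"
    using cinner_commute[of x y] cinner_commute[of "T x" y] T[of x y] by simp
  show "0 \<le> Re (cinner x (T x) - of_real c * cinner x x)"
    using assms(2)[of x] by (simp add: cinner_norm)
qed

lemma positive_form_scalar_diff:
  assumes "hermitian T" "\<And>x. Re (cinner x (T x)) \<le> c * (norm x)\<^sup>2"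
  shows "positive_form (\<lambda>x y. complex_of_real c * cinner x y - cinner x (T y))"
proof
  fix x y z :: 'a and d
  have T: "cinner (T x) y = cinner x (T y)" for x y
    using assms(1) by (simp add: hermitian_def)
  have "bounded_clinear T" using assms(1) by (simp add: hermitian_def)
  note bl = bounded_clinearD[OF this]
  show "of_real c * cinner x (y + z) - cinner x (T (y + z))
      = of_real c * cinner x y - cinner x (T y) + (of_real c * cinner x z - cinner x (T z))"
    by (simp add: bl cinner.add_right algebra_simps)
  show "of_real c * cinner x (d *\<^sub>C y) - cinner x (T (d *\<^sub>C y))
      = d * (of_real c * cinner x y - cinner x (T y))"
    by (simp add: bl cinner.scaleC_right algebra_simps)
  show "of_real c * cinner x y - cinner x (T y) = cnj (of_real c * cinner y x - cinner y (T x))"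
    using cinner_commute[of x y] cinner_commute[of "T x" y] T[of x y] by simp
  show "0 \<le> Re (of_real c * cinner x x - cinner x (T x))"
    using assms(2)[of x] by (simp add: cinner_norm)
qed

context hilbert_tensor
begin

text \<open>Telescoping: \<open>\<rho> \<otimes> \<sigma> - a b = (\<rho> - a) \<otimes> \<sigma> +
  a (1 \<otimes> (\<sigma> - b))\<close>, where each term is positive by the Schur product, and
  likewise for \<open>A B - \<rho> \<otimes> \<sigma>\<close>. The span comes first, then its
  closure.\<close>

lemma tensor_quadratic_bounds:
  assumes R: "bounded_clinear R" "\<And>x y. R (t x y) = t (\<rho> x) (\<sigma> y)"
    and \<rho>: "positive_op \<rho>" and \<sigma>: "positive_op \<sigma>" and "0 \<le> a" "0 \<le> A"
    and a: "\<And>x. a * (norm x)\<^sup>2 \<le> Re (cinner x (\<rho> x))"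
    and A: "\<And>x. Re (cinner x (\<rho> x)) \<le> A * (norm x)\<^sup>2"
    and b: "\<And>y. b * (norm y)\<^sup>2 \<le> Re (cinner y (\<sigma> y))"
    and B: "\<And>y. Re (cinner y (\<sigma> y)) \<le> B * (norm y)\<^sup>2"
  shows "a * b * (norm z)\<^sup>2 \<le> Re (cinner z (R z))" and "Re (cinner z (R z)) \<le> A * B * (norm z)\<^sup>2"
proof -
  let ?S = "complex_vector.span {t x y |x y. True}"
  have h: "hermitian \<rho>" "hermitian \<sigma>" using \<rho> \<sigma> by (auto simp: positive_op_iff)
  have span: "a * b * (norm z)\<^sup>2 \<le> Re (cinner z (R z)) \<and> Re (cinner z (R z)) \<le> A * B * (norm z)\<^sup>2"
    if zS: "z \<in> ?S" for z
  proof -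
    obtain n :: nat and x y where z: "z = (\<Sum>i<n. t (x i) (y i))" using span_tensor_sum[OF zS] by blast
    define q where "q S T = (\<Sum>i<n. \<Sum>j<n. cinner (x i) (S (x j)) * cinner (y i) (T (y j)))" for S T
    have zz: "cinner z z = q (\<lambda>x. x) (\<lambda>x. x)" unfolding z inner_sum q_def ..
    have zR: "cinner z (R z) = q \<rho> \<sigma>"
      unfolding z bounded_clinear_simps(4)[OF R(1)] R(2) inner_sum q_def ..
    have Schur: "0 \<le> Re (\<Sum>i<n. \<Sum>j<n. F (x i) (x j) * G (y i) (y j))"
      if "positive_form F" "positive_form G" for F G
      using that by (intro Schur_product_nonneg) auto
    note pf = cinner.positive_form_axioms positive_op_form[OF \<sigma>]
    have "0 \<le> Re (q \<rho> \<sigma> - of_real a * q (\<lambda>x. x) \<sigma>)"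
      using Schur[OF positive_form_diff_scalar[OF h(1) a] pf(2)]
      by (simp add: q_def sum_subtractf sum_distrib_left algebra_simps)
    moreover have "0 \<le> a * Re (q (\<lambda>x. x) \<sigma> - of_real b * q (\<lambda>x. x) (\<lambda>x. x))"
      using Schur[OF pf(1) positive_form_diff_scalar[OF h(2) b]] \<open>0 \<le> a\<close>
      by (intro mult_nonneg_nonneg) (simp_all add: q_def sum_subtractf sum_distrib_left algebra_simps)
    moreover have "0 \<le> Re (of_real A * q (\<lambda>x. x) \<sigma> - q \<rho> \<sigma>)"
      using Schur[OF positive_form_scalar_diff[OF h(1) A] pf(2)]
      by (simp add: q_def sum_subtractf sum_distrib_left algebra_simps)
    moreover have "0 \<le> A * Re (of_real B * q (\<lambda>x. x) (\<lambda>x. x) - q (\<lambda>x. x) \<sigma>)"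
      using Schur[OF pf(1) positive_form_scalar_diff[OF h(2) B]] \<open>0 \<le> A\<close>
      by (intro mult_nonneg_nonneg) (simp_all add: q_def sum_subtractf sum_distrib_left algebra_simps)
    moreover have "(norm z)\<^sup>2 = Re (q (\<lambda>x. x) (\<lambda>x. x))" using Re_cinner_self[of z] zz by simp
    ultimately show ?thesis unfolding zR by (simp add: algebra_simps)
  qed
  have "closed {z. a * b * (norm z)\<^sup>2 \<le> Re (cinner z (R z)) \<and> Re (cinner z (R z)) \<le> A * B * (norm z)\<^sup>2}"
    by (intro closed_Collect_conj closed_Collect_le continuous_intros bounded_clinear_continuous_on R)
  hence "closure ?S \<subseteq> {z. a * b * (norm z)\<^sup>2 \<le> Re (cinner z (R z)) \<and> Re (cinner z (R z)) \<le> A * B * (norm z)\<^sup>2}"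
    using span by (intro closure_minimal) auto
  thus "a * b * (norm z)\<^sup>2 \<le> Re (cinner z (R z))" "Re (cinner z (R z)) \<le> A * B * (norm z)\<^sup>2"
    using dense by auto
qed

text \<open>\<open>l\<close> and \<open>L\<close> are existential because only the constant they
  produce matters; they need not be the products of the eigenvalues.\<close>

lemma tilted_states:
  fixes v :: "'i \<Rightarrow> 'h" and w :: "'j \<Rightarrow> 'k"
  assumes \<rho>: "state \<rho>" and \<sigma>: "state \<sigma>" and v: "gram_family v \<rho>" and w: "gram_family w \<sigma>"
    and ne: "largest_eigenvalue \<rho> * largest_eigenvalue \<sigma> \<noteq> smallest_eigenvalue \<rho> * smallest_eigenvalue \<sigma>"
  obtains l L where "0 \<le> l" "l < L" "tilted (\<lambda>(k, j). t (v k) (w j)) l L"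
    "(largest_eigenvalue \<rho> * largest_eigenvalue \<sigma> + smallest_eigenvalue \<rho> * smallest_eigenvalue \<sigma>)
      / (2 * (largest_eigenvalue \<rho> * largest_eigenvalue \<sigma> - smallest_eigenvalue \<rho> * smallest_eigenvalue \<sigma>))
     = (L + l) / (2 * (L - l))"
proof (cases "(\<exists>S :: 'h set. finite S \<and> complex_vector.span S = UNIV) \<and>
    (\<exists>S :: 'k set. finite S \<and> complex_vector.span S = UNIV)")
  case True
  hence fdH: "\<exists>S :: 'h set. finite S \<and> complex_vector.span S = UNIV"
    and fdK: "\<exists>S :: 'k set. finite S \<and> complex_vector.span S = UNIV" by blast+
  note e\<rho> = finite_dimensional_state_eigenvalues[OF \<rho> fdH]
    and e\<sigma> = finite_dimensional_state_eigenvalues[OF \<sigma> fdK]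
  define l where "l = smallest_eigenvalue \<rho> * smallest_eigenvalue \<sigma>"
  define L where "L = largest_eigenvalue \<rho> * largest_eigenvalue \<sigma>"
  obtain E :: "'h set" where E: "is_onb E" using state_onb[OF \<rho>] by blast
  obtain F :: "'k set" where F: "is_onb F" using state_onb[OF \<sigma>] by blast
  have fin: "finite E" "finite F"
    using fdH fdK finite_onb_iff_finite_dimensional[OF E] finite_onb_iff_finite_dimensional[OF F] by blast+
  have "{t e f |e f. e \<in> E \<and> f \<in> F} = (\<lambda>(e, f). t e f) ` (E \<times> F)" by auto
  hence finEF: "finite {t e f |e f. e \<in> E \<and> f \<in> F}" using fin by simp
  have "0 \<le> l" "l \<le> L"
    using e\<rho>(1,4) e\<sigma>(1,4) unfolding l_def L_def by (auto intro: mult_mono)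
  have pos: "positive_op \<rho>" "positive_op \<sigma>" using \<rho> \<sigma> by (auto simp: state_def)
  have "0 \<le> largest_eigenvalue \<rho>" using e\<rho>(1,4) by linarith
  note bounds = tensor_quadratic_bounds[OF gram_family_tensor(2,3)[OF v w] pos e\<rho>(1) this
      e\<rho>(2,3) e\<sigma>(2,3), folded l_def L_def]
  have "0 \<le> L" using \<open>0 \<le> l\<close> \<open>l \<le> L\<close> by linarith
  have "tilted (\<lambda>(k, j). t (v k) (w j)) l L"
    by (rule tilted_finite_dimensional[OF is_onb_tensor[OF E F] finEF gram_family_tensor(1)[OF v w]
          \<open>0 \<le> l\<close> \<open>0 \<le> L\<close> bounds])
  moreover have "l < L" using \<open>l \<le> L\<close> ne by (simp add: l_def L_def)
  ultimately show ?thesis using that \<open>0 \<le> l\<close> unfolding l_def L_def by blast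
next
  case False
  hence 0: "smallest_eigenvalue \<rho> * smallest_eigenvalue \<sigma> = 0"
    using infinite_dimensional_state_smallest_eigenvalue[OF \<rho>]
      infinite_dimensional_state_smallest_eigenvalue[OF \<sigma>] by (metis mult_zero_left mult_zero_right)
  \<comment> \<open>Here the constant is 1/2 whatever the largest eigenvalues are, and the pair 0, 1
    reproduces it. Tilting with \<open>l = 0\<close> is mere nonnegativity.\<close>
  show ?thesis
  proof (rule that[of 0 1])
    show "tilted (\<lambda>(k, j). t (v k) (w j)) 0 1" by (simp add: tilted_def gram_inner_self(2))
  qed (use 0 ne in simp_all)
qed

end

section \<open>The error-disturbance inequality\<close>

lemma hermitian_diff_scalar:
  assumes "hermitian T"
  shows "hermitian (\<lambda>x. T x - complex_of_real c *\<^sub>C x)"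
  using assms unfolding hermitian_def
  by (auto intro!: bounded_clinear_diff bounded_clinear_scaleC
      simp: cinner.diff_left cinner.diff_right cinner.scaleC_left cinner.scaleC_right)

lemma unitary_cadjoint:
  assumes U: "unitary U"
  shows "cadjoint U (U x) = x" "U (cadjoint U y) = y" "cinner (cadjoint U y) x = cinner y (U x)"
    "bounded_clinear (cadjoint U)"
proof -
  have bl: "bounded_clinear U" and iso: "\<And>x y. cinner (U x) (U y) = cinner x y" and "surj U"
    using U by (auto simp: unitary_def)
  have "inj U"
  proof (rule injI)
    fix x y assume "U x = U y"
    hence "cinner z x = cinner z y" for z using iso by metis
    thus "x = y" by (rule cinner_ext)
  qed
  define V where "V = inv U"
  have V: "V (U x) = x" "U (V y) = y" for x y
    using \<open>inj U\<close> \<open>surj U\<close> by (simp_all add: V_def surj_f_inv_f)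
  have adj: "cinner (V x) y = cinner x (U y)" for x y
    using iso[of "V x" y] by (simp add: V)
  have "norm (V x) = norm x" for x
  proof -
    have "(norm (V x))\<^sup>2 = (norm x)\<^sup>2"
      unfolding Re_cinner_self[symmetric] using iso[of "V x" "V x"] by (simp only: V)
    thus ?thesis by (simp add: power2_eq_iff_nonneg)
  qed
  moreover have "V (x + y) = V x + V y" "V (c *\<^sub>C x) = c *\<^sub>C V x" for x y c
    by (rule injD[OF \<open>inj U\<close>], simp add: V bounded_clinearD[OF bl])+
  ultimately have "bounded_clinear V"
    unfolding bounded_clinear_def by (auto intro: exI[of _ 1])
  moreover have "cadjoint U = V" by (rule cadjoint_eqI[OF adj])
  ultimately show "cadjoint U (U x) = x" "U (cadjoint U y) = y"
    "cinner (cadjoint U y) x = cinner y (U x)" "bounded_clinear (cadjoint U)"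
    using V adj by simp_all
qed

lemma hermitian_conjugate:
  assumes U: "unitary U" and T: "hermitian T"
  shows "hermitian (\<lambda>z. cadjoint U (T (U z)))"
proof -
  note V = unitary_cadjoint[OF U]
  have "bounded_clinear U" using U by (simp add: unitary_def)
  have "cinner x (cadjoint U y) = cinner (U x) y" for x y
    using V(3)[of y x] by (metis cinner_commute)
  thus ?thesis
    using T \<open>bounded_clinear U\<close> V(3,4)
    by (auto simp: hermitian_def intro: bounded_clinear_compose)
qed

lemma hermitian_diff: "hermitian S \<Longrightarrow> hermitian T \<Longrightarrow> hermitian (\<lambda>x. S x - T x)"
  by (auto simp: hermitian_def cinner.diff_left cinner.diff_right intro: bounded_clinear_diff)

text \<open>The mean is real, so subtracting it as in \<open>std_dev\<close> keeps an observable
  Hermitian.\<close>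

lemma expect_hermitian:
  assumes onb: "\<exists>E :: 'a::complex_hilbert_space set. is_onb E" and v: "gram_family v \<rho>"
    and X: "hermitian (X :: 'a \<Rightarrow> 'a)"
  shows "expect \<rho> X = complex_of_real (Re (expect \<rho> X))"
proof -
  have bl: "bounded_clinear X" using X by (simp add: hermitian_def)
  have "expect \<rho> X = (\<Sum>\<^sub>\<infinity>i. cinner (v i) (X (v i)))"
    unfolding expect_def
    by (rule op_trace_gram_family(1)[OF onb v bl bl]) (use X in \<open>simp add: hermitian_def\<close>)
  moreover have "cinner x (X x) = complex_of_real (Re (cinner x (X x)))" for x
    using hermitian_Im_self[OF X, of x] X by (simp add: complex_eq_iff hermitian_def)
  ultimately have "expect \<rho> X = complex_of_real (\<Sum>\<^sub>\<infinity>i. Re (cinner (v i) (X (v i))))"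
    by (metis (no_types, lifting) infsum_cong infsum_complex_of_real)
  thus ?thesis by simp
qed

lemma op_trace_square:
  assumes onb: "\<exists>E :: 'a::complex_hilbert_space set. is_onb E" and v: "gram_family v \<rho>"
    and X: "hermitian (X :: 'a \<Rightarrow> 'a)"
  shows "op_trace (X \<circ> X \<circ> \<rho>) = gram_inner v X X" "op_trace (\<rho> \<circ> (X \<circ> X)) = gram_inner v X X"
proof -
  have bl: "bounded_clinear (X \<circ> X)"
    using X bounded_clinear_compose[of X X] by (simp add: hermitian_def o_def)
  have adj: "cinner ((X \<circ> X) x) y = cinner x ((X \<circ> X) y)" for x y
    using X by (simp add: hermitian_def)
  show "op_trace (X \<circ> X \<circ> \<rho>) = gram_inner v X X" "op_trace (\<rho> \<circ> (X \<circ> X)) = gram_inner v X X"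
    unfolding op_trace_gram_family[OF onb v bl bl adj]
    using X by (simp_all add: gram_inner_def hermitian_def)
qed

lemma cmod_expect_commutator:
  assumes onb: "\<exists>E :: 'a::complex_hilbert_space set. is_onb E" and v: "gram_family v \<rho>"
    and A: "hermitian (A :: 'a \<Rightarrow> 'a)" and B: "hermitian B"
  shows "cmod (expect \<rho> (commutator A B)) = \<bar>2 * Im (gram_inner v A B)\<bar>"
proof -
  have hA: "bounded_clinear A" "\<And>x y. cinner (A x) y = cinner x (A y)"
    and hB: "bounded_clinear B" "\<And>x y. cinner (B x) y = cinner x (B y)"
    using A B by (auto simp: hermitian_def)
  have bl: "bounded_clinear (commutator A B)" "bounded_clinear (commutator B A)"
    unfolding commutator_def using hA(1) hB(1) by (auto intro: bounded_clinear_diff bounded_clinear_compose)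
  have adj: "cinner (commutator B A x) y = cinner x (commutator A B y)" for x y
    by (simp add: commutator_def cinner.diff_left cinner.diff_right hA hB)
  have hs: "((\<lambda>i. cinner (A (v i)) (B (v i))) has_sum gram_inner v A B) UNIV"
    unfolding gram_inner_def by (rule gram_family_has_sum[OF onb v hA(1) hB(1)])
  have "cinner x (commutator A B x) = 2 * \<i> * complex_of_real (Im (cinner (A x) (B x)))" for x
  proof -
    have "cinner x (commutator A B x) = cinner (A x) (B x) - cnj (cinner (A x) (B x))"
      using cinner_commute[of "B x" "A x"] by (simp add: commutator_def cinner.diff_right hA hB)
    thus ?thesis by (simp add: complex_eq_iff)
  qed
  moreover have "((\<lambda>i. 2 * \<i> * complex_of_real (Im (cinner (A (v i)) (B (v i))))) has_sum
      2 * \<i> * complex_of_real (Im (gram_inner v A B))) UNIV"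
    by (intro has_sum_cmult_right has_sum_of_real has_sum_Im hs)
  ultimately have "expect \<rho> (commutator A B) = 2 * \<i> * complex_of_real (Im (gram_inner v A B))"
    unfolding expect_def op_trace_gram_family(1)[OF onb v bl adj] by (simp add: infsumI)
  thus ?thesis by (simp add: norm_mult)
qed

theorem mainTheorem6:
  fixes tens :: "'h::{complex_hilbert_space, second_countable_topology} \<Rightarrow>
      'k::{complex_hilbert_space, second_countable_topology} \<Rightarrow> 'hk::complex_hilbert_space"
    and \<rho> A B :: "'h \<Rightarrow> 'h"
    and \<rho>app Aapp :: "'k \<Rightarrow> 'k"
    and U :: "'hk \<Rightarrow> 'hk"
    and lmax lmin mmax mmin :: real
  assumes "hilbert_tensor_product tens"
    and "state \<rho>" and "state \<rho>app"
    and "lmax = largest_eigenvalue \<rho>" and "lmin = smallest_eigenvalue \<rho>"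
    and "mmax = largest_eigenvalue \<rho>app" and "mmin = smallest_eigenvalue \<rho>app"
    and "lmax * mmax \<noteq> lmin * mmin"
    and "hermitian A" and "hermitian B" and "hermitian Aapp"
    and "unitary U"
  shows "meas_error tens \<rho> \<rho>app U Aapp A * disturbance tens \<rho> \<rho>app U B
       + meas_error tens \<rho> \<rho>app U Aapp A * std_dev \<rho> B
       + std_dev \<rho> A * disturbance tens \<rho> \<rho>app U B
     \<ge> (lmax * mmax + lmin * mmin) / (2 * (lmax * mmax - lmin * mmin))
         * cmod (expect \<rho> (commutator A B))"
proof -
  interpret hilbert_tensor tens by unfold_locales (rule assms(1))
  obtain v :: "nat \<Rightarrow> 'h" where v: "gram_family v \<rho>" using state_gram_family[OF assms(2)] by blast
  obtain w :: "nat \<Rightarrow> 'k" where w: "gram_family w \<rho>app" using state_gram_family[OF assms(3)] by blast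
  define g where "g = (\<lambda>(k, j). tens (v k) (w j))"
  define R where "R = tensor_op tens \<rho> \<rho>app"
  have g: "gram_family g R" unfolding g_def R_def by (rule gram_family_tensor(1)[OF v w])
  note onbH = state_onb[OF assms(2)] and onbK = state_onb[OF assms(3)]
  \<comment> \<open>\<open>op_trace\<close> chooses a basis of the composite space, so one has to
    exist there.\<close>
  have onb: "\<exists>E :: 'hk set. is_onb E" using onbH onbK is_onb_tensor by blast
  obtain l L where lL: "0 \<le> l" "l < L" "tilted g l L"
    and \<kappa>: "(lmax * mmax + lmin * mmin) / (2 * (lmax * mmax - lmin * mmin)) = (L + l) / (2 * (L - l))"
    using tilted_states[OF assms(2,3) v w] assms(4-8) unfolding g_def by metis
  define \<kappa> where "\<kappa> = (L + l) / (2 * (L - l))"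
  have "0 \<le> \<kappa>" using lL by (simp add: \<kappa>_def)
  \<comment> \<open>Trace one of the apparatus state, read off its Gram family with
    \<open>id\<close> as the observable.\<close>
  have "op_trace (id \<circ> \<rho>app) = (\<Sum>\<^sub>\<infinity>j. cinner (w j) (id (w j)))"
    by (rule op_trace_gram_family(1)[OF onbK w bounded_clinear_id bounded_clinear_id]) simp
  hence "(\<Sum>\<^sub>\<infinity>j. complex_of_real ((norm (w j))\<^sup>2)) = 1"
    using assms(3) by (simp add: state_def cinner_norm del: of_real_power)
  hence "(\<Sum>\<^sub>\<infinity>j. (norm (w j))\<^sup>2) = 1"
    unfolding infsum_complex_of_real by (metis of_real_eq_1_iff)
  hence one: "((\<lambda>j. (norm (w j))\<^sup>2) has_sum 1) UNIV"
    using w by (simp add: gram_family_def has_sum_iff)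
  have marginal: "gram_inner g (tensor_op tens X id) (tensor_op tens Y id) = gram_inner v X Y"
    if "bounded_clinear X" "bounded_clinear Y" for X Y
    using gram_sum_marginal[OF onb v w one that] unfolding gram_inner_def g_def by (simp add: split_beta')

  define center where "center X = (\<lambda>x. X x - complex_of_real (Re (expect \<rho> X)) *\<^sub>C x)" for X
  have center: "hermitian (center X)" "std_dev \<rho> X = sqrt (Re (gram_inner g (tensor_op tens (center X) id)
      (tensor_op tens (center X) id)))" if X: "hermitian X" for X
  proof -
    show h: "hermitian (center X)" unfolding center_def by (rule hermitian_diff_scalar[OF X])
    have "(\<lambda>x. X x - expect \<rho> X *\<^sub>C x) = center X"
      unfolding center_def using expect_hermitian[OF onbH v X] by metis
    hence "std_dev \<rho> X = sqrt (Re (gram_inner v (center X) (center X)))"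
      unfolding std_dev_def Let_def by (simp only: op_trace_square(1)[OF onbH v h])
    thus "std_dev \<rho> X = sqrt (Re (gram_inner g (tensor_op tens (center X) id)
      (tensor_op tens (center X) id)))"
      using h by (simp add: marginal hermitian_def)
  qed
  define A' where "A' = tensor_op tens (center A) id"
  define B' where "B' = tensor_op tens (center B) id"
  define a where "a = Re (expect \<rho> A)"
  define b where "b = Re (expect \<rho> B)"
  have hA': "hermitian A'" and hB': "hermitian B'"
    unfolding A'_def B'_def using assms(9,10) center(1) hermitian_left by blast+
  have shift: "tensor_op tens (center X) id z
      = tensor_op tens X id z - complex_of_real (Re (expect \<rho> X)) *\<^sub>C z"
    if X: "hermitian X" for X z
  proof -
    have bl: "bounded_clinear X" using X by (simp add: hermitian_def)
    have "tensor_op tens (center X) id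
      = (\<lambda>z. tensor_op tens X id z - complex_of_real (Re (expect \<rho> X)) *\<^sub>C z)"
      using bounded_clinear_simps(2)[OF bounded_clinear_left]
      by (intro tensor_op_eqI bounded_clinear_diff bounded_clinear_scaleC tensor_op_left[OF bl])
        (simp add: tensor_op_left[OF bl] center_def scaleC_left)
    thus ?thesis by (rule fun_cong)
  qed

  define M where "M = (\<lambda>z. cadjoint U (tensor_op tens id Aapp (U z)))"
  define V where "V = (\<lambda>z. cadjoint U (tensor_op tens B id (U z)))"
  have hM: "hermitian M" and hV: "hermitian V"
    unfolding M_def V_def
    using hermitian_conjugate[OF assms(12)] hermitian_right[OF assms(11)] hermitian_left[OF assms(10)]
    by blast+
  \<comment> \<open>The inner \<open>U\<close> and \<open>cadjoint U\<close> cancel, leaving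
    operators that act on different tensor factors.\<close>
  have MV: "M (V z) = V (M z)" for z
    using commute_left_right[of B Aapp] assms(10,11)
    by (simp add: M_def V_def unitary_cadjoint[OF assms(12)] hermitian_def)
  define N where "N = noise_op tens U Aapp A"
  define D where "D = disturbance_op tens U B"
  have N: "N = (\<lambda>z. M z - tensor_op tens A id z)" and D: "D = (\<lambda>z. V z - tensor_op tens B id z)"
    by (simp_all add: N_def D_def M_def V_def noise_op_def disturbance_op_def)
  have hN: "hermitian N" and hD: "hermitian D"
    unfolding N D using hM hV assms(9,10) by (auto intro: hermitian_diff hermitian_left)
  have err: "meas_error tens \<rho> \<rho>app U Aapp A = sqrt (Re (gram_inner g N N))"
    and dist: "disturbance tens \<rho> \<rho>app U B = sqrt (Re (gram_inner g D D))"
    by (simp_all only: meas_error_def disturbance_def Let_def N_def[symmetric] D_def[symmetric]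
        R_def[symmetric] op_trace_square(2)[OF onb g hN] op_trace_square(2)[OF onb g hD])

  have bl: "bounded_clinear A'" "bounded_clinear B'" "bounded_clinear N" "bounded_clinear D"
    using hA' hB' hN hD by (auto simp: hermitian_def)
  have hs: "((\<lambda>i. Im (cinner (X (g i)) (Y (g i)))) has_sum Im (gram_inner g X Y)) UNIV"
    if "bounded_clinear X" "bounded_clinear Y" for X Y
    unfolding gram_inner_def by (intro has_sum_Im gram_family_has_sum[OF onb g that])
  \<comment> \<open>Up to real shifts \<open>N + A'\<close> and \<open>D + B'\<close> are the
    commuting Hermitian operators \<open>M\<close> and \<open>V\<close>, for which
    \<open>cinner (M z) (V z)\<close> is real. The commutator identity thus holds as an identity of
    imaginary parts at each vector.\<close>
  have pointwise: "Im (cinner (N z) (D z)) + Im (cinner (N z) (B' z)) + Im (cinner (A' z) (D z))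
      + Im (cinner (A' z) (B' z)) = 0" for z
  proof -
    have "cinner (M z) (V z) = cinner (V z) (M z)"
      using MV[of z] hM hV by (metis hermitian_def)
    hence MV0: "Im (cinner (M z) (V z)) = 0"
      using cinner_commute[of "M z" "V z"] by (metis Im_complex_of_real Reals_cnj_iff Reals_cases)
    have NA: "N z + A' z = M z - of_real a *\<^sub>C z" and DB: "D z + B' z = V z - of_real b *\<^sub>C z"
      by (simp_all add: N D A'_def B'_def shift assms(9,10) a_def b_def)
    have "Im (cinner z (V z)) = 0"
      using hermitian_Im_self[OF hV, of z] hV by (simp add: hermitian_def)
    hence "Im (cinner (N z + A' z) (D z + B' z)) = 0"
      unfolding NA DB
      by (simp add: cinner.diff_left cinner.diff_right cinner.scaleC_left cinner.scaleC_right MV0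
          hermitian_Im_self[OF hM])
    thus ?thesis by (simp add: cinner.add_left cinner.add_right)
  qed
  have "((\<lambda>i. Im (cinner (N (g i)) (D (g i))) + Im (cinner (N (g i)) (B' (g i)))
      + Im (cinner (A' (g i)) (D (g i))) + Im (cinner (A' (g i)) (B' (g i)))) has_sum
      (Im (gram_inner g N D) + Im (gram_inner g N B') + Im (gram_inner g A' D) + Im (gram_inner g A' B'))) UNIV"
    by (intro has_sum_add hs bl)
  hence total: "Im (gram_inner g N D) + Im (gram_inner g N B') + Im (gram_inner g A' D)
      + Im (gram_inner g A' B') = 0"
    unfolding pointwise by (rule has_sum_unique) simp

  \<comment> \<open>Centering subtracts real scalars, which change the inner products of the
    Hermitian \<open>A\<close> and \<open>B\<close> only by real terms.\<close>
  have "Im (gram_inner g A' B') = Im (gram_inner v A B)"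
  proof -
    have blA: "bounded_clinear A" "bounded_clinear (center A)" and blB: "bounded_clinear B" "bounded_clinear (center B)"
      using assms(9,10) center(1) by (auto simp: hermitian_def)
    have "Im (cinner (center A x) (center B x)) = Im (cinner (A x) (B x))" for x
      using hermitian_Im_self[OF assms(9), of x] hermitian_Im_self[OF assms(10), of x] assms(10)
      by (simp add: center_def cinner.diff_left cinner.diff_right cinner.scaleC_left
          cinner.scaleC_right hermitian_def)
    hence "((\<lambda>i. Im (cinner (A (v i)) (B (v i)))) has_sum Im (gram_inner v (center A) (center B))) UNIV"
      using has_sum_Im[OF gram_family_has_sum[OF onbH v blA(2) blB(2)]] by (simp only: gram_inner_def)
    hence "Im (gram_inner v (center A) (center B)) = Im (gram_inner v A B)"
      unfolding gram_inner_def
      by (rule has_sum_unique[OF _ has_sum_Im[OF gram_family_has_sum[OF onbH v blA(1) blB(1)]]])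
    thus ?thesis unfolding A'_def B'_def by (simp add: marginal blA blB)
  qed
  hence "cmod (expect \<rho> (commutator A B)) = \<bar>2 * Im (gram_inner g A' B')\<bar>"
    using cmod_expect_commutator[OF onbH v assms(9,10)] by simp
  also have "\<dots> \<le> \<bar>2 * Im (gram_inner g N D)\<bar> + \<bar>2 * Im (gram_inner g N B')\<bar>
      + \<bar>2 * Im (gram_inner g A' D)\<bar>"
    using total by linarith
  finally have "\<kappa> * cmod (expect \<rho> (commutator A B)) \<le> \<kappa> * (\<bar>2 * Im (gram_inner g N D)\<bar>
      + \<bar>2 * Im (gram_inner g N B')\<bar> + \<bar>2 * Im (gram_inner g A' D)\<bar>)"
    using \<open>0 \<le> \<kappa>\<close> by (rule mult_left_mono)
  moreover have rob: "\<kappa> * \<bar>2 * Im (gram_inner g X Y)\<bar>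
      \<le> sqrt (Re (gram_inner g X X)) * sqrt (Re (gram_inner g Y Y))"
    if "hermitian X" "hermitian Y" for X Y
    unfolding \<kappa>_def by (rule weighted_Robertson[OF onb g lL that])
  ultimately show ?thesis
    using rob[OF hN hD] rob[OF hN hB'] rob[OF hA' hD]
    unfolding \<kappa> \<kappa>_def[symmetric] err dist center(2)[OF assms(9)] center(2)[OF assms(10)]
      A'_def[symmetric] B'_def[symmetric]
    by (simp add: distrib_left)
qed

end
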